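(* Consider a time consistent dynamic risk measure $(\rho_{\sigma,\tau})_{0\le\sigma\le\tau}$ on $(\Omega,\mathcal F_\infty,(\mathcal F_t)_{t\in\mathbb R^+},P)$ that is continuous from above, normalized and non degenerate. Assume that $\mathcal M^0_{0,\infty}\ne\emptyset$ or that the risk measure is continuous from below. Let $X\in L^\infty(\mathcal F_\infty)$. For every $Q\in\mathcal M^0_{0,\infty}$, there is a c\`adl\`ag $Q$-supermartingale process $Y$ such that for every finite stopping time $\sigma$, $\rho_{\sigma,\infty}(X)=Y_\sigma$ in $L^\infty(\Omega,\mathcal F_\sigma,P)$.
   Context: Setting: $(\Omega,\mathcal F_\infty,(\mathcal F_t)_{t\in\mathbb R^+},P)$ is a filtered probability space; the filtration is right continuous and $\mathcal F_0$ is the $\sigma$-algebra generated by the $P$-null sets of $\mathcal F_\infty$. Stopping times may take the value $\infty$; $\mathcal F_\tau=\{A\in\mathcal F_\infty: A\cap\{\tau\le t\}\in\mathcal F_t\ \forall t\in\mathbb R^+\}$. Functions are identified with their classes in $L^\infty(\mathcal F_\tau)=L^\infty(\Omega,\mathcal F_\tau,P)$. Dynamic risk measure: a family of maps $\rho_{\sigma,\tau}:L^\infty(\mathcal F_\tau)\to L^\infty(\mathcal F_\sigma)$, indexed by pairs of stopping times $0\le\sigma\le\tau$, each satisfying ($P$-a.s.): monotonicity ($X\le Y\Rightarrow\rho_{\sigma,\tau}(X)\ge\rho_{\sigma,\tau}(Y)$); translation invariance ($\rho_{\sigma,\tau}(X+Z)=\rho_{\sigma,\tau}(X)-Z$ for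 $Z\in L^\infty(\mathcal F_\sigma)$); convexity ($\rho_{\sigma,\tau}(\lambda X+(1-\lambda)Y)\le\lambda\rho_{\sigma,\tau}(X)+(1-\lambda)\rho_{\sigma,\tau}(Y)$ for $\lambda\in[0,1]$). Normalized: $\rho_{\sigma,\tau}(0)=0$ for all $\sigma\le\tau$. Continuous from above (resp. below): for all $\sigma\le\tau$ and every decreasing (resp. increasing) sequence $X_n$ in $L^\infty(\mathcal F_\tau)$ with a.s. limit $X\in L^\infty(\mathcal F_\tau)$, the increasing (resp. decreasing) sequence $\rho_{\sigma,\tau}(X_n)$ has limit $\rho_{\sigma,\tau}(X)$ a.s. Time consistent: for all stopping times $0\le\nu\le\sigma\le\tau$ and $X\in L^\infty(\mathcal F_\tau)$, $\rho_{\nu,\sigma}(-\rho_{\sigma,\tau}(X))=\rho_{\nu,\tau}(X)$. Non degenerate: for every $A\in\mathcal F_\infty$, if $\rho_{0,\infty}(\lambda 1_A)=\rho_{0,\infty}(0)$ for all real $\lambda>0$, then $P(A)=0$. Minimal penalty: for a probability measure $Q\ll P$, $$\alpha^m_{\sigma,\tau}(Q)=Q\text{-}\operatorname{ess\,sup}_{X\in L^\infty(\Omega,\mathcal F_\tau,P)}\big(E_Q(-X\mid\mathcal F_\sigma)-\rho_{\sigma,\tau}(X)\big).$$ $\mathcal M^0_{0,\infty}$ is the set of probability measures $Q$ on $(\Omega,\mathcal F_\infty)$ with $Q\ll P$ and $\alpha^m_{0,\infty}(Q)=0$. A $Q$-supermartingale is a supermartingale under $Q$ for the filtration $(\mathcal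 F_t)$. *)

theory Defs
  imports "HOL-Probability.Probability" "HOL-Probability.Stopping_Time"
begin

text \<open>
  Time runs through \<^typ>\<open>ennreal\<close> = \<open>[0,\<infinity>]\<close>.  The probability space \<open>(\<Omega>, F\<^sub>\<infinity>, P)\<close> is \<open>M\<close>;
  the filtration \<open>(F\<^sub>t)\<close> over the nonnegative reals and the \<open>\<sigma>\<close>-algebra \<open>F\<^sub>\<infinity>\<close> are packed
  into one family \<open>F\<close> with \<open>F \<infinity> = F\<^sub>\<infinity>\<close> (which may be larger than what the \<open>F\<^sub>t\<close>, \<open>t < \<infinity>\<close>,
  generate).  With this choice \<^const>\<open>stopping_time\<close> gives exactly the stopping times with values
  in \<open>[0,\<infinity>]\<close>, and for the index \<open>t = \<infinity>\<close> the condition in the definition of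
  \<open>pre_sigma\<close> reads \<open>A \<in> F\<^sub>\<infinity>\<close>.
\<close>

locale filtered_prob_space =
  prob_space M + filtration "space M" F
  for M :: "'a measure" and F :: "ennreal \<Rightarrow> 'a measure" +
  assumes sets_F_top: "sets (F \<infinity>) = sets M"
    and right_continuous: "\<And>t. t < \<infinity> \<Longrightarrow> sets (F t) = (\<Inter>s\<in>{t<..}. sets (F s))"
    and sets_F_0: "sets (F 0) = sigma_sets (space M) (null_sets M)"

abbreviation sigma_at :: "'a measure \<Rightarrow> (ennreal \<Rightarrow> 'a measure) \<Rightarrow> ('a \<Rightarrow> ennreal) \<Rightarrow> 'a measure" where
  "sigma_at M F \<tau> \<equiv> filtration.pre_sigma (space M) F \<tau>"

text \<open>Elements of \<open>L\<^sup>\<infinity>\<close> are handled through representatives; equality in \<open>L\<^sup>\<infinity>\<close> is \<open>M\<close>-a.e. equality.\<close>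

definition Linf :: "'a measure \<Rightarrow> 'a measure \<Rightarrow> ('a \<Rightarrow> real) set" where
  "Linf M G = {X \<in> borel_measurable G. \<exists>C. AE \<omega> in M. \<bar>X \<omega>\<bar> \<le> C}"

definition ordered_stopping_times ::
    "'a measure \<Rightarrow> (ennreal \<Rightarrow> 'a measure) \<Rightarrow> ('a \<Rightarrow> ennreal) \<Rightarrow> ('a \<Rightarrow> ennreal) \<Rightarrow> bool" where
  "ordered_stopping_times M F \<sigma> \<tau> \<longleftrightarrow>
     stopping_time F \<sigma> \<and> stopping_time F \<tau> \<and> (\<forall>\<omega>\<in>space M. \<sigma> \<omega> \<le> \<tau> \<omega>)"

type_synonym 'a risk = "('a \<Rightarrow> ennreal) \<Rightarrow> ('a \<Rightarrow> ennreal) \<Rightarrow> ('a \<Rightarrow> real) \<Rightarrow> ('a \<Rightarrow> real)"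

text \<open>Monotonicity makes each \<open>\<rho> \<sigma> \<tau>\<close> compatible with a.e. equality, so it induces
  a map on the classes.\<close>

definition dynamic_risk_measure ::
    "'a measure \<Rightarrow> (ennreal \<Rightarrow> 'a measure) \<Rightarrow> 'a risk \<Rightarrow> bool" where
  "dynamic_risk_measure M F \<rho> \<longleftrightarrow> (\<forall>\<sigma> \<tau>. ordered_stopping_times M F \<sigma> \<tau> \<longrightarrow>
     (\<forall>X\<in>Linf M (sigma_at M F \<tau>). \<rho> \<sigma> \<tau> X \<in> Linf M (sigma_at M F \<sigma>)) \<and>
     (\<forall>X\<in>Linf M (sigma_at M F \<tau>). \<forall>Y\<in>Linf M (sigma_at M F \<tau>).
        (AE \<omega> in M. X \<omega> \<le> Y \<omega>) \<longrightarrow> (AE \<omega> in M. \<rho> \<sigma> \<tau> X \<omega> \<ge> \<rho> \<sigma> \<tau> Y \<omega>)) \<and>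
     (\<forall>X\<in>Linf M (sigma_at M F \<tau>). \<forall>Z\<in>Linf M (sigma_at M F \<sigma>).
        AE \<omega> in M. \<rho> \<sigma> \<tau> (\<lambda>\<omega>. X \<omega> + Z \<omega>) \<omega> = \<rho> \<sigma> \<tau> X \<omega> - Z \<omega>) \<and>
     (\<forall>X\<in>Linf M (sigma_at M F \<tau>). \<forall>Y\<in>Linf M (sigma_at M F \<tau>). \<forall>c\<in>{0..1::real}.
        AE \<omega> in M. \<rho> \<sigma> \<tau> (\<lambda>\<omega>. c * X \<omega> + (1 - c) * Y \<omega>) \<omega>
                     \<le> c * \<rho> \<sigma> \<tau> X \<omega> + (1 - c) * \<rho> \<sigma> \<tau> Y \<omega>))"

definition normalized :: "'a measure \<Rightarrow> (ennreal \<Rightarrow> 'a measure) \<Rightarrow> 'a risk \<Rightarrow> bool" where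
  "normalized M F \<rho> \<longleftrightarrow> (\<forall>\<sigma> \<tau>. ordered_stopping_times M F \<sigma> \<tau> \<longrightarrow>
     (AE \<omega> in M. \<rho> \<sigma> \<tau> (\<lambda>_. 0) \<omega> = 0))"

definition continuous_from_above :: "'a measure \<Rightarrow> (ennreal \<Rightarrow> 'a measure) \<Rightarrow> 'a risk \<Rightarrow> bool" where
  "continuous_from_above M F \<rho> \<longleftrightarrow> (\<forall>\<sigma> \<tau> X Xn. ordered_stopping_times M F \<sigma> \<tau> \<longrightarrow>
     X \<in> Linf M (sigma_at M F \<tau>) \<longrightarrow> (\<forall>n::nat. Xn n \<in> Linf M (sigma_at M F \<tau>)) \<longrightarrow>
     (AE \<omega> in M. decseq (\<lambda>n. Xn n \<omega>)) \<longrightarrow> (AE \<omega> in M. (\<lambda>n. Xn n \<omega>) \<longlonglongrightarrow> X \<omega>) \<longrightarrow>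
     (AE \<omega> in M. (\<lambda>n. \<rho> \<sigma> \<tau> (Xn n) \<omega>) \<longlonglongrightarrow> \<rho> \<sigma> \<tau> X \<omega>))"

definition continuous_from_below :: "'a measure \<Rightarrow> (ennreal \<Rightarrow> 'a measure) \<Rightarrow> 'a risk \<Rightarrow> bool" where
  "continuous_from_below M F \<rho> \<longleftrightarrow> (\<forall>\<sigma> \<tau> X Xn. ordered_stopping_times M F \<sigma> \<tau> \<longrightarrow>
     X \<in> Linf M (sigma_at M F \<tau>) \<longrightarrow> (\<forall>n::nat. Xn n \<in> Linf M (sigma_at M F \<tau>)) \<longrightarrow>
     (AE \<omega> in M. incseq (\<lambda>n. Xn n \<omega>)) \<longrightarrow> (AE \<omega> in M. (\<lambda>n. Xn n \<omega>) \<longlonglongrightarrow> X \<omega>) \<longrightarrow>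
     (AE \<omega> in M. (\<lambda>n. \<rho> \<sigma> \<tau> (Xn n) \<omega>) \<longlonglongrightarrow> \<rho> \<sigma> \<tau> X \<omega>))"

definition time_consistent :: "'a measure \<Rightarrow> (ennreal \<Rightarrow> 'a measure) \<Rightarrow> 'a risk \<Rightarrow> bool" where
  "time_consistent M F \<rho> \<longleftrightarrow> (\<forall>\<nu> \<sigma> \<tau>.
     ordered_stopping_times M F \<nu> \<sigma> \<longrightarrow> ordered_stopping_times M F \<sigma> \<tau> \<longrightarrow>
     (\<forall>X\<in>Linf M (sigma_at M F \<tau>).
        AE \<omega> in M. \<rho> \<nu> \<sigma> (\<lambda>\<omega>. - \<rho> \<sigma> \<tau> X \<omega>) \<omega> = \<rho> \<nu> \<tau> X \<omega>))"

definition non_degenerate :: "'a measure \<Rightarrow> 'a risk \<Rightarrow> bool" where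
  "non_degenerate M \<rho> \<longleftrightarrow> (\<forall>A\<in>sets M.
     (\<forall>c>0. AE \<omega> in M. \<rho> (\<lambda>_. 0) (\<lambda>_. \<infinity>) (\<lambda>\<omega>. c * indicator A \<omega>) \<omega>
                        = \<rho> (\<lambda>_. 0) (\<lambda>_. \<infinity>) (\<lambda>_. 0) \<omega>)
     \<longrightarrow> measure M A = 0)"

text \<open>Essential supremum of a (possibly uncountable) family of random variables: the a.e. least
  measurable a.e. upper bound.  It is unique only up to null sets, hence a predicate.\<close>

definition is_ess_sup :: "'a measure \<Rightarrow> ('a \<Rightarrow> ereal) set \<Rightarrow> ('a \<Rightarrow> ereal) \<Rightarrow> bool" where
  "is_ess_sup N S Z \<longleftrightarrow>
     Z \<in> borel_measurable N \<and> (\<forall>f\<in>S. AE \<omega> in N. f \<omega> \<le> Z \<omega>) \<and>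
     (\<forall>Z'\<in>borel_measurable N. (\<forall>f\<in>S. AE \<omega> in N. f \<omega> \<le> Z' \<omega>) \<longrightarrow> (AE \<omega> in N. Z \<omega> \<le> Z' \<omega>))"

text \<open>\<open>is_min_penalty M F \<rho> \<sigma> \<tau> Q a\<close> means that \<open>a\<close> is a version of the minimal penalty
  \<open>\<alpha>\<^sup>m\<^bsub>\<sigma>,\<tau>\<^esub>(Q)\<close>.\<close>

definition is_min_penalty ::
    "'a measure \<Rightarrow> (ennreal \<Rightarrow> 'a measure) \<Rightarrow> 'a risk \<Rightarrow> ('a \<Rightarrow> ennreal) \<Rightarrow> ('a \<Rightarrow> ennreal) \<Rightarrow>
     'a measure \<Rightarrow> ('a \<Rightarrow> ereal) \<Rightarrow> bool" where
  "is_min_penalty M F \<rho> \<sigma> \<tau> Q a \<longleftrightarrow>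
     is_ess_sup Q
       ((\<lambda>X \<omega>. ereal (real_cond_exp Q (sigma_at M F \<sigma>) (\<lambda>\<omega>. - X \<omega>) \<omega> - \<rho> \<sigma> \<tau> X \<omega>))
          ` Linf M (sigma_at M F \<tau>)) a"

definition zero_penalty_measures ::
    "'a measure \<Rightarrow> (ennreal \<Rightarrow> 'a measure) \<Rightarrow> 'a risk \<Rightarrow> 'a measure set" where
  "zero_penalty_measures M F \<rho> =
     {Q. prob_space Q \<and> sets Q = sets M \<and> absolutely_continuous M Q \<and>
         is_min_penalty M F \<rho> (\<lambda>_. 0) (\<lambda>_. \<infinity>) Q (\<lambda>_. 0)}"

text \<open>Processes over the nonnegative reals are functions on \<^typ>\<open>real\<close>, of which only the values at
  times \<open>t \<ge> 0\<close> matter.\<close>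

definition supermartingale ::
    "'a measure \<Rightarrow> (ennreal \<Rightarrow> 'a measure) \<Rightarrow> (real \<Rightarrow> 'a \<Rightarrow> real) \<Rightarrow> bool" where
  "supermartingale Q F Y \<longleftrightarrow>
     (\<forall>t\<ge>0. Y t \<in> borel_measurable (F (ennreal t)) \<and> integrable Q (Y t)) \<and>
     (\<forall>s t. 0 \<le> s \<and> s \<le> t \<longrightarrow>
        (AE \<omega> in Q. real_cond_exp Q (F (ennreal s)) (Y t) \<omega> \<le> Y s \<omega>))"

definition cadlag :: "(real \<Rightarrow> real) \<Rightarrow> bool" where
  "cadlag y \<longleftrightarrow>
     (\<forall>t\<ge>0. continuous (at_right t) y) \<and> (\<forall>t>0. \<exists>l. (y \<longlongrightarrow> l) (at_left t))"

text \<open>The value at time \<open>\<sigma>\<close>, for a.s. finite \<open>\<sigma>\<close>; on \<open>\<sigma> = \<infinity>\<close> it is the irrelevant \<open>Y 0 \<omega>\<close>.\<close>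

definition value_at :: "(real \<Rightarrow> 'a \<Rightarrow> real) \<Rightarrow> ('a \<Rightarrow> ennreal) \<Rightarrow> 'a \<Rightarrow> real" where
  "value_at Y \<sigma> \<omega> = Y (enn2real (\<sigma> \<omega>)) \<omega>"

end

theory Submission
  imports Defs
begin

text \<open>
  Write \<open>r \<sigma>\<close> for \<open>\<rho>\<^bsub>\<sigma>,\<infinity>\<^esub>\<close>.  If \<open>Q\<close> has zero penalty then \<open>E\<^sub>Q(-X) \<le> r 0 X\<close>, and non-degeneracy forces
  \<open>Q\<close> to be equivalent to \<open>P\<close>.  Monotonicity and translation invariance make \<open>r \<sigma>\<close> local, so that
  applying the inequality to \<open>1\<^sub>A (Z + r \<sigma> Z)\<close> with \<open>Z = - r \<tau> X\<close>, whose risk at time \<open>0\<close> vanishes by time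
  consistency, gives \<open>E\<^sub>Q(r \<tau> X | F\<^sub>\<sigma>) \<le> r \<sigma> X\<close> for all stopping times \<open>\<sigma> \<le> \<tau>\<close>.  By Doob's upcrossing
  inequality the process \<open>r t X\<close> has one-sided limits along the dyadic times, and the process \<open>Y\<close> of its
  right limits is cadlag.

  That \<open>Y\<^sub>\<sigma> = r \<sigma> X\<close> needs right continuity of the risk along stopping times \<open>s\<^sub>n\<close> decreasing to \<open>\<sigma>\<close>.  If
  \<open>r s\<^sub>n X\<close> tends to \<open>L\<close>, continuity from above in its Fatou form is applied twice: to \<open>- r s\<^sub>n X\<close>, of
  constant risk \<open>r \<sigma> X\<close>, which gives \<open>L = r \<sigma> (-L) \<le> r \<sigma> X\<close>; and to \<open>X + r s\<^sub>n X\<close>, which has zero risk at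
  \<open>s\<^sub>n\<close> and hence at \<open>\<sigma>\<close>, which gives \<open>r \<sigma> X - L = r \<sigma> (X + L) \<le> 0\<close>.
\<close>

subsection \<open>Upcrossings and one-sided limits along the dyadic numbers\<close>

text \<open>The trading rule behind Doob's upcrossing inequality: buy once the path is below
  \<open>a\<close>, sell once it is above \<open>b\<close>. The state at \<open>k\<close> depends on
  \<open>w 0, ..., w k\<close> only, so it may be used as the stake on the increment from
  \<open>k\<close> to \<open>Suc k\<close>.\<close>

fun holding :: "real \<Rightarrow> real \<Rightarrow> (nat \<Rightarrow> real) \<Rightarrow> nat \<Rightarrow> bool" where
  "holding a b w 0 \<longleftrightarrow> w 0 < a"
| "holding a b w (Suc k) \<longleftrightarrow> (if holding a b w k then w (Suc k) \<le> b else w (Suc k) < a)"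

declare holding.simps [simp del]

text \<open>A completed upcrossing is recorded by the last index before its sale, so the sale itself
  takes place at an index up to \<open>n\<close>.\<close>

definition upcrossing_times :: "real \<Rightarrow> real \<Rightarrow> (nat \<Rightarrow> real) \<Rightarrow> nat \<Rightarrow> nat set" where
  "upcrossing_times a b w n = {j. j < n \<and> holding a b w j \<and> \<not> holding a b w (Suc j)}"

lemma finite_upcrossing_times [simp]: "finite (upcrossing_times a b w n)"
  by (simp add: upcrossing_times_def)

lemma card_upcrossing_times_Suc:
  "card (upcrossing_times a b w (Suc n)) =
     card (upcrossing_times a b w n) + of_bool (holding a b w n \<and> \<not> holding a b w (Suc n))"
proof -
  have "upcrossing_times a b w (Suc n) =
      (if holding a b w n \<and> \<not> holding a b w (Suc n) then insert n (upcrossing_times a b w n)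
       else upcrossing_times a b w n)"
    by (auto simp: upcrossing_times_def less_Suc_eq)
  moreover have "n \<notin> upcrossing_times a b w n"
    by (simp add: upcrossing_times_def)
  ultimately show ?thesis
    by simp
qed

text \<open>The pathwise form of Doob's inequality. Every purchase is made below \<open>a\<close>
  and every sale above \<open>b\<close>, so each round trip earns at least \<open>b - a\<close>; a
  position still open at \<open>n\<close> is valued as if bought at \<open>a\<close>, which is more
  than was paid.\<close>

lemma upcrossing_gain:
  assumes "a < b"
  shows "(b - a) * card (upcrossing_times a b w n) + (if holding a b w n then w n - a else 0)
     \<le> (\<Sum>k<n. of_bool (holding a b w k) * (w (Suc k) - w k))"
proof (induction n)
  case 0
  then show ?case by (simp add: upcrossing_times_def holding.simps)
next
  case (Suc n)
  then show ?case using assms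
    by (auto simp: card_upcrossing_times_Suc holding.simps algebra_simps split: if_splits)
qed

lemma holding_below: "w s < a \<Longrightarrow> a < b \<Longrightarrow> holding a b w s"
  by (cases s) (auto simp: holding.simps)

lemma not_holding_above: "b < w s \<Longrightarrow> a < b \<Longrightarrow> \<not> holding a b w s"
  by (cases s) (auto simp: holding.simps)

text \<open>Without a sale in between, the state of holding would propagate from \<open>s\<close> to
  \<open>t\<close> by induction.\<close>

lemma holding_switch:
  assumes "s < t" "holding a b w s" "\<not> holding a b w t"
  shows "\<exists>j. s \<le> j \<and> j < t \<and> holding a b w j \<and> \<not> holding a b w (Suc j)"
proof (rule ccontr)
  assume *: "\<not> ?thesis"
  have "holding a b w k" if "s \<le> k" "k \<le> t" for k
    using that
  proof (induction k rule: dec_induct)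
    case base
    then show ?case using assms by simp
  next
    case (step k)
    then show ?case using * by (metis Suc_le_lessD less_imp_le)
  qed
  then show False using assms by auto
qed

text \<open>A certificate that \<open>v\<close> rises from below \<open>a\<close> to above
  \<open>b\<close> at least \<open>card I\<close> times within \<open>S\<close>. Time is an
  arbitrary linear order, so that families of real times can be compared with families of grid
  indices.\<close>

definition crossings :: "real \<Rightarrow> real \<Rightarrow> ('t::linorder \<Rightarrow> real) \<Rightarrow> 't set \<Rightarrow> ('t \<times> 't) set \<Rightarrow> bool" where
  "crossings a b v S I \<longleftrightarrow> finite I \<and>
     (\<forall>i\<in>I. fst i \<in> S \<and> snd i \<in> S \<and> fst i < snd i \<and> v (fst i) < a \<and> b < v (snd i)) \<and>
     (\<forall>i\<in>I. \<forall>j\<in>I. i \<noteq> j \<longrightarrow> snd i \<le> fst j \<or> snd j \<le> fst i)"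

text \<open>Between a value below \<open>a\<close> and a later value above \<open>b\<close> the
  trading rule must sell, and the sales found in non-overlapping intervals are distinct.\<close>

lemma crossings_le_upcrossings:
  assumes "crossings a b w {..n} I" "a < b"
  shows "card I \<le> card (upcrossing_times a b w n)"
proof -
  have "\<exists>j. fst i \<le> j \<and> j < snd i \<and> holding a b w j \<and> \<not> holding a b w (Suc j)" if "i \<in> I" for i
    using that assms
    by (intro holding_switch) (auto simp: crossings_def holding_below not_holding_above)
  then obtain g where g: "\<And>i. i \<in> I \<Longrightarrow> fst i \<le> g i \<and> g i < snd i \<and> holding a b w (g i) \<and> \<not> holding a b w (Suc (g i))"
    by metis
  have "inj_on g I"
  proof (rule inj_onI, rule ccontr)
    fix i j assume "i \<in> I" "j \<in> I" "g i = g j" "i \<noteq> j"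
    with g[of i] g[of j] assms(1) show False
      unfolding crossings_def by (metis leD le_less_trans less_le_trans)
  qed
  moreover have "g ` I \<subseteq> upcrossing_times a b w n"
    using g assms(1) by (fastforce simp: upcrossing_times_def crossings_def)
  ultimately show ?thesis
    by (metis card_image card_mono finite_upcrossing_times)
qed

section \<open>Crossings at dyadic times and on dyadic grids\<close>

definition nonneg_dyadics :: "real set" where
  "nonneg_dyadics = {x. \<exists>k n::nat. x = real k / 2 ^ n}"

lemma countable_dyadics: "countable nonneg_dyadics"
proof -
  have "nonneg_dyadics = (\<lambda>(k, n). real k / 2 ^ n) ` (UNIV :: (nat \<times> nat) set)"
    by (auto simp: nonneg_dyadics_def)
  then show ?thesis by (metis countableI_type countable_image)
qed

lemma dyadic_on_fine_grids:
  assumes "x \<in> nonneg_dyadics"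
  shows "\<forall>\<^sub>F n in sequentially. \<exists>k::nat. x = real k / 2 ^ n"
proof -
  obtain k m :: nat where x: "x = real k / 2 ^ m"
    using assms by (auto simp: nonneg_dyadics_def)
  have "\<exists>k::nat. x = real k / 2 ^ n" if "n \<ge> m" for n
  proof
    show "x = real (k * 2 ^ (n - m)) / 2 ^ n"
      using that by (simp add: x field_simps flip: power_add)
  qed
  then show ?thesis
    by (auto simp: eventually_sequentially)
qed

text \<open>The finitely many endpoints in \<open>I\<close> all lie on every sufficiently fine grid.
  Multiplication by \<open>2 ^ n\<close> then turns them into indices up to \<open>N * 2 ^ n\<close>
  and preserves their order.\<close>

lemma dyadic_crossings_le_upcrossings:
  fixes N :: nat
  assumes I: "crossings a b v (nonneg_dyadics \<inter> {..real N}) I" and "a < b"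
  shows "\<forall>\<^sub>F n in sequentially. card I \<le> card (upcrossing_times a b (\<lambda>k. v (real k / 2 ^ n)) (N * 2 ^ n))"
proof -
  have "\<forall>\<^sub>F n in sequentially. \<forall>i\<in>I. (\<exists>k::nat. fst i = real k / 2 ^ n) \<and> (\<exists>k::nat. snd i = real k / 2 ^ n)"
    using I by (intro eventually_ball_finite ballI eventually_conj dyadic_on_fine_grids)
      (auto simp: crossings_def)
  then show ?thesis
  proof eventually_elim
    case (elim n)
    then obtain p q where pq: "\<And>i. i \<in> I \<Longrightarrow> fst i = real (p i) / 2 ^ n \<and> snd i = real (q i) / 2 ^ n"
      by metis
    have less: "real x / 2 ^ n < real y / 2 ^ n \<longleftrightarrow> x < y" "real x / 2 ^ n \<le> real y / 2 ^ n \<longleftrightarrow> x \<le> y"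
      for x y :: nat
      by (simp_all add: divide_less_cancel divide_le_cancel)
    have le_N: "real x / 2 ^ n \<le> real N \<longleftrightarrow> x \<le> N * 2 ^ n" for x :: nat
    proof -
      have "real x \<le> real N * 2 ^ n \<longleftrightarrow> real x \<le> real (N * 2 ^ n)" by simp
      then show ?thesis unfolding of_nat_le_iff by (simp add: divide_le_eq)
    qed
    define J where "J = (\<lambda>i. (p i, q i)) ` I"
    have "inj_on (\<lambda>i. (p i, q i)) I"
      using pq by (auto simp: inj_on_def prod_eq_iff)
    then have "card J = card I"
      by (simp add: J_def card_image)
    moreover have "crossings a b (\<lambda>k. v (real k / 2 ^ n)) {..N * 2 ^ n} J"
      unfolding crossings_def J_def
    proof (intro conjI ballI)
      show "finite ((\<lambda>i. (p i, q i)) ` I)"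
        using I by (simp add: crossings_def)
    next
      fix i' assume "i' \<in> (\<lambda>i. (p i, q i)) ` I"
      then obtain i where i: "i \<in> I" "i' = (p i, q i)" by auto
      have "fst i \<le> real N \<and> snd i \<le> real N \<and> fst i < snd i \<and> v (fst i) < a \<and> b < v (snd i)"
        using I i by (auto simp: crossings_def)
      then show "fst i' \<in> {..N * 2 ^ n}" "snd i' \<in> {..N * 2 ^ n}" "fst i' < snd i'"
        "v (real (fst i') / 2 ^ n) < a" "b < v (real (snd i') / 2 ^ n)"
        using pq[OF i(1)] i by (auto simp: less le_N)
    next
      fix i' j' assume "i' \<in> (\<lambda>i. (p i, q i)) ` I" "j' \<in> (\<lambda>i. (p i, q i)) ` I"
      then obtain i j where ij: "i \<in> I" "j \<in> I" "i' = (p i, q i)" "j' = (p j, q j)" by auto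
      show "i' \<noteq> j' \<longrightarrow> snd i' \<le> fst j' \<or> snd j' \<le> fst i'"
      proof
        assume "i' \<noteq> j'"
        then have "snd i \<le> fst j \<or> snd j \<le> fst i"
          using I ij by (auto simp: crossings_def)
        then show "snd i' \<le> fst j' \<or> snd j' \<le> fst i'"
          using pq[OF ij(1)] pq[OF ij(2)] ij by (simp add: less)
      qed
    qed
    ultimately show ?case
      using crossings_le_upcrossings[OF _ \<open>a < b\<close>] by metis
  qed
qed

section \<open>From finitely many crossings to one-sided limits\<close>

lemma crossings_insert:
  assumes "crossings a b v S I" "p \<in> S" "q \<in> S" "p < q" "v p < a" "b < v q"
    and "\<And>i. i \<in> I \<Longrightarrow> q \<le> fst i \<or> snd i \<le> p"
  shows "crossings a b v S (insert (p, q) I)" "card (insert (p, q) I) = Suc (card I)"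
proof -
  have "(p, q) \<notin> I"
    using assms(4) assms(7)[of "(p, q)"] by auto
  with assms(1) show "card (insert (p, q) I) = Suc (card I)"
    by (simp add: crossings_def)
  show "crossings a b v S (insert (p, q) I)"
    using assms by (auto simp: crossings_def)
qed

text \<open>Oscillation persists arbitrarily close to \<open>t\<close>, so a further crossing always
  fits between \<open>t\<close> and the crossings already found: first its end \<open>q\<close> is
  chosen before all of them, then its start \<open>p\<close> between \<open>t\<close> and
  \<open>q\<close>.\<close>

lemma many_crossings_right:
  fixes v :: "real \<Rightarrow> real"
  assumes low: "\<exists>\<^sub>F x in at t within S \<inter> {t<..}. v x < a"
    and high: "\<exists>\<^sub>F x in at t within S \<inter> {t<..}. b < v x" and "t < u"
  shows "\<exists>I. crossings a b v (S \<inter> {t<..<u}) I \<and> card I = m"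
proof (induction m)
  case 0
  show ?case by (rule exI[of _ "{}"]) (simp add: crossings_def)
next
  case (Suc m)
  then obtain I where I: "crossings a b v (S \<inter> {t<..<u}) I" "card I = m" by auto
  have ev: "\<forall>\<^sub>F x in at t within S \<inter> {t<..}. x \<in> S \<and> t < x \<and> x < r" if "t < r" for r
    unfolding eventually_at using that by (auto simp: dist_real_def intro!: exI[of _ "r - t"])
  have "\<forall>\<^sub>F x in at t within S \<inter> {t<..}. \<forall>i\<in>I. x < fst i"
  proof (intro eventually_ball_finite ballI)
    show "finite I" using I by (simp add: crossings_def)
    fix i assume "i \<in> I"
    then have "t < fst i" using I by (auto simp: crossings_def)
    from ev[OF this] show "\<forall>\<^sub>F x in at t within S \<inter> {t<..}. x < fst i"
      by eventually_elim simp
  qed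
  from frequently_eventually_conj[OF high eventually_conj[OF this ev[OF \<open>t < u\<close>]]]
  obtain q where q: "b < v q" "\<forall>i\<in>I. q < fst i" "q \<in> S" "t < q" "q < u"
    using frequently_ex by blast
  from frequently_eventually_conj[OF low ev[OF \<open>t < q\<close>]]
  obtain p where p: "v p < a" "p \<in> S" "t < p" "p < q"
    using frequently_ex by blast
  have "q \<le> fst i \<or> snd i \<le> p" if "i \<in> I" for i
    using that q(2) by (auto intro: less_imp_le)
  from crossings_insert[OF I(1) _ _ \<open>p < q\<close> \<open>v p < a\<close> \<open>b < v q\<close> this] show ?case
    using p q I(2) by (intro exI[of _ "insert (p, q) I"]) auto
qed

text \<open>The mirror image: the new crossing comes after all earlier ones, so its start
  \<open>p\<close> is chosen first and its end \<open>q\<close> between \<open>p\<close> and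
  \<open>t\<close>.\<close>

lemma many_crossings_left:
  fixes v :: "real \<Rightarrow> real"
  assumes low: "\<exists>\<^sub>F x in at t within S \<inter> {..<t}. v x < a"
    and high: "\<exists>\<^sub>F x in at t within S \<inter> {..<t}. b < v x"
  shows "\<exists>I. crossings a b v (S \<inter> {..<t}) I \<and> card I = m"
proof (induction m)
  case 0
  show ?case by (rule exI[of _ "{}"]) (simp add: crossings_def)
next
  case (Suc m)
  then obtain I where I: "crossings a b v (S \<inter> {..<t}) I" "card I = m" by auto
  have ev: "\<forall>\<^sub>F x in at t within S \<inter> {..<t}. x \<in> S \<and> x < t \<and> r < x" if "r < t" for r
    unfolding eventually_at using that by (auto simp: dist_real_def intro!: exI[of _ "t - r"])
  have "\<forall>\<^sub>F x in at t within S \<inter> {..<t}. \<forall>i\<in>I. snd i < x"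
  proof (intro eventually_ball_finite ballI)
    show "finite I" using I by (simp add: crossings_def)
    fix i assume "i \<in> I"
    then have "snd i < t" using I by (auto simp: crossings_def)
    from ev[OF this] show "\<forall>\<^sub>F x in at t within S \<inter> {..<t}. snd i < x"
      by eventually_elim simp
  qed
  moreover have "\<forall>\<^sub>F x in at t within S \<inter> {..<t}. x \<in> S \<and> x < t"
    using ev[of "t - 1"] by (auto elim: eventually_mono)
  ultimately obtain p where p: "v p < a" "\<forall>i\<in>I. snd i < p" "p \<in> S" "p < t"
    using frequently_eventually_conj[OF low eventually_conj] frequently_ex by blast
  from frequently_eventually_conj[OF high ev[OF \<open>p < t\<close>]]
  obtain q where q: "b < v q" "q \<in> S" "q < t" "p < q"
    using frequently_ex by blast
  have "q \<le> fst i \<or> snd i \<le> p" if "i \<in> I" for i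
    using that p(2) by (auto intro: less_imp_le)
  from crossings_insert[OF I(1) _ _ \<open>p < q\<close> \<open>v p < a\<close> \<open>b < v q\<close> this] show ?case
    using p q I(2) by (intro exI[of _ "insert (p, q) I"]) auto
qed

text \<open>
  A bound for infinitely many grids is all that Fatou's lemma yields; it suffices because finitely many
  crossings between dyadic times are seen on every sufficiently fine grid.
\<close>

definition finite_upcrossings :: "(real \<Rightarrow> real) \<Rightarrow> bool" where
  "finite_upcrossings v \<longleftrightarrow> (\<forall>a\<in>\<rat>. \<forall>b\<in>\<rat>. a < b \<longrightarrow> (\<forall>N. \<exists>m. \<exists>\<^sub>F n in sequentially.
     card (upcrossing_times a b (\<lambda>k. v (real k / 2 ^ n)) (N * 2 ^ n)) < m))"

lemma finite_upcrossingsD: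
  assumes "finite_upcrossings v" "a \<in> \<rat>" "b \<in> \<rat>" "a < b"
  shows "\<exists>m. \<forall>I. crossings a b v (nonneg_dyadics \<inter> {..real N}) I \<longrightarrow> card I \<noteq> m"
proof -
  obtain m where m: "\<exists>\<^sub>F n in sequentially.
     card (upcrossing_times a b (\<lambda>k. v (real k / 2 ^ n)) (N * 2 ^ n)) < m"
    using assms unfolding finite_upcrossings_def by blast
  have "card I \<noteq> m" if "crossings a b v (nonneg_dyadics \<inter> {..real N}) I" for I
    using frequently_eventually_conj[OF m dyadic_crossings_le_upcrossings[OF that \<open>a < b\<close>]]
    by (auto dest!: frequently_ex)
  then show ?thesis by blast
qed

text \<open>The limit is the limit superior, taken as the supremum of the levels that are exceeded
  frequently. A general filter covers limits from the left and from the right at once.\<close>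

lemma bounded_no_oscillation_converges:
  fixes f :: "'b \<Rightarrow> real"
  assumes bounded: "\<forall>\<^sub>F x in G. \<bar>f x\<bar> \<le> C"
    and osc: "\<And>a b. a \<in> \<rat> \<Longrightarrow> b \<in> \<rat> \<Longrightarrow> a < b \<Longrightarrow>
      \<not> ((\<exists>\<^sub>F x in G. f x < a) \<and> (\<exists>\<^sub>F x in G. b < f x))"
  shows "\<exists>l. (f \<longlongrightarrow> l) G"
proof (cases "G = bot")
  case False
  define S where "S = {c. \<exists>\<^sub>F x in G. c < f x}"
  \<comment> \<open>Eventually all values lie above \<open>- C - 1\<close>, so this level shows that
    \<open>S\<close> is nonempty.\<close>
  have "- C - 1 \<in> S"
    unfolding S_def mem_Collect_eq using bounded
    by (intro eventually_frequently[OF False]) (auto elim: eventually_mono)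
  then have ne: "S \<noteq> {}" by auto
  have bdd: "bdd_above S"
  proof (rule bdd_aboveI)
    fix c assume "c \<in> S"
    then have "\<exists>\<^sub>F x in G. c < f x \<and> \<bar>f x\<bar> \<le> C"
      unfolding S_def mem_Collect_eq using bounded by (auto dest: frequently_eventually_conj simp: conj_commute)
    then show "c \<le> C" by (auto dest!: frequently_ex)
  qed
  have "(f \<longlongrightarrow> Sup S) G"
  proof (rule order_tendstoI)
    fix c assume "c < Sup S"
    then obtain b0 where b0: "b0 \<in> S" "c < b0"
      using less_cSup_iff[OF ne bdd] by auto
    \<comment> \<open>Two rationals are placed between \<open>c\<close> and \<open>b0\<close>: the
      upper one is exceeded frequently, hence values below the lower one cannot recur, which keeps
      \<open>f\<close> above \<open>c\<close> eventually.\<close>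
    obtain b where b: "b \<in> \<rat>" "c < b" "b < b0"
      using Rats_dense_in_real[OF b0(2)] by blast
    obtain a where a: "a \<in> \<rat>" "c < a" "a < b"
      using Rats_dense_in_real[OF b(2)] by blast
    have "\<exists>\<^sub>F x in G. b < f x"
      using b0(1) b(3) unfolding S_def mem_Collect_eq by (auto elim!: frequently_elim1)
    then have "\<not> (\<exists>\<^sub>F x in G. f x < a)"
      using osc[OF a(1) b(1) a(3)] by auto
    then show "\<forall>\<^sub>F x in G. c < f x"
      using a(2) by (auto simp: not_frequently not_less elim!: eventually_mono)
  next
    fix c assume c: "Sup S < c"
    obtain c' where "Sup S < c'" "c' < c"
      using dense[OF c] by blast
    then have "c' \<notin> S"
      using cSup_upper[OF _ bdd, of c'] by auto
    then show "\<forall>\<^sub>F x in G. f x < c"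
      using \<open>c' < c\<close> by (auto simp: S_def not_frequently not_less elim!: eventually_mono)
  qed
  then show ?thesis by blast
qed simp

text \<open>If a limit failed to exist at \<open>t\<close>, two rational levels would be crossed as
  often as desired near \<open>t\<close>, against the bound on crossings up to an integer horizon
  beyond \<open>t\<close>.\<close>

lemma dyadic_one_sided_limits:
  assumes v: "finite_upcrossings v" "\<And>d. d \<in> nonneg_dyadics \<Longrightarrow> \<bar>v d\<bar> \<le> C"
  shows "\<exists>l. (v \<longlongrightarrow> l) (at t within nonneg_dyadics \<inter> {t<..})"
    and "\<exists>l. (v \<longlongrightarrow> l) (at t within nonneg_dyadics \<inter> {..<t})"
proof -
  have dy: "\<forall>\<^sub>F x in at t within nonneg_dyadics \<inter> S. \<bar>v x\<bar> \<le> C" for S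
    using v(2) by (auto simp: eventually_at_filter)
  define N where "N = nat \<lceil>t\<rceil> + 1"
  have N: "t < real N" unfolding N_def by linarith
  show "\<exists>l. (v \<longlongrightarrow> l) (at t within nonneg_dyadics \<inter> {t<..})"
  proof (rule bounded_no_oscillation_converges[OF dy])
    fix a b :: real assume ab: "a \<in> \<rat>" "b \<in> \<rat>" "a < b"
    obtain m where m: "\<And>I. crossings a b v (nonneg_dyadics \<inter> {..real N}) I \<Longrightarrow> card I \<noteq> m"
      using finite_upcrossingsD[OF v(1) ab] by blast
    have "crossings a b v (nonneg_dyadics \<inter> {..real N}) I" if "crossings a b v (nonneg_dyadics \<inter> {t<..<real N}) I" for I
      using that by (auto simp: crossings_def)
    then show "\<not> ((\<exists>\<^sub>F x in at t within nonneg_dyadics \<inter> {t<..}. v x < a) \<and> (\<exists>\<^sub>F x in at t within nonneg_dyadics \<inter> {t<..}. b < v x))"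
      using many_crossings_right[of v a t nonneg_dyadics b "real N" m] N m by blast
  qed
  show "\<exists>l. (v \<longlongrightarrow> l) (at t within nonneg_dyadics \<inter> {..<t})"
  proof (rule bounded_no_oscillation_converges[OF dy])
    fix a b :: real assume ab: "a \<in> \<rat>" "b \<in> \<rat>" "a < b"
    obtain m where m: "\<And>I. crossings a b v (nonneg_dyadics \<inter> {..real N}) I \<Longrightarrow> card I \<noteq> m"
      using finite_upcrossingsD[OF v(1) ab] by blast
    have "crossings a b v (nonneg_dyadics \<inter> {..real N}) I" if "crossings a b v (nonneg_dyadics \<inter> {..<t}) I" for I
      using that N by (fastforce simp: crossings_def)
    then show "\<not> ((\<exists>\<^sub>F x in at t within nonneg_dyadics \<inter> {..<t}. v x < a) \<and> (\<exists>\<^sub>F x in at t within nonneg_dyadics \<inter> {..<t}. b < v x))"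
      using many_crossings_left[of v a t nonneg_dyadics b m] m by blast
  qed
qed

section \<open>Dyadic approximation from the right and cadlag right limits\<close>

definition dyadic_above :: "nat \<Rightarrow> real \<Rightarrow> real" where
  "dyadic_above n t = real (nat \<lfloor>t * 2 ^ n\<rfloor> + 1) / 2 ^ n"

lemma dyadic_above_dyadic: "dyadic_above n t \<in> nonneg_dyadics"
  unfolding dyadic_above_def nonneg_dyadics_def by blast

text \<open>Floor plus one, in place of a ceiling, makes the inequality strict even when
  \<open>t\<close> is itself dyadic, so the approximation stays in the punctured right neighbourhood
  of \<open>t\<close>.\<close>

lemma dyadic_above_greater: "t < dyadic_above n t"
proof -
  have "t * 2 ^ n < real (nat \<lfloor>t * 2 ^ n\<rfloor> + 1)" by linarith
  then show ?thesis by (simp add: dyadic_above_def field_simps)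
qed

lemma dyadic_above_le: "0 \<le> t \<Longrightarrow> dyadic_above n t \<le> t + 1 / 2 ^ n"
proof -
  assume "0 \<le> t"
  then have "0 \<le> t * 2 ^ n" by simp
  then have "real (nat \<lfloor>t * 2 ^ n\<rfloor> + 1) \<le> t * 2 ^ n + 1" by linarith
  then show ?thesis by (simp add: dyadic_above_def field_simps)
qed

lemma dyadic_above_Suc_le: "0 \<le> t \<Longrightarrow> dyadic_above (Suc n) t \<le> dyadic_above n t"
proof -
  assume "0 \<le> t"
  then have "0 \<le> t * 2 ^ n" by simp
  \<comment> \<open>The grids are nested: halving the mesh doubles the index of the cell containing
    \<open>t\<close> and adds at most one, so the right end of the cell does not move to the
    right.\<close>
  moreover have "nat \<lfloor>2 * x\<rfloor> + 1 \<le> 2 * (nat \<lfloor>x\<rfloor> + 1)" if "0 \<le> x" for x :: real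
  proof -
    have "\<lfloor>2 * x\<rfloor> \<le> 2 * \<lfloor>x\<rfloor> + 1" "0 \<le> \<lfloor>x\<rfloor>" using that by linarith+
    then have "nat \<lfloor>2 * x\<rfloor> \<le> 2 * nat \<lfloor>x\<rfloor> + 1" by (simp add: nat_le_iff)
    then show ?thesis by simp
  qed
  ultimately have "nat \<lfloor>2 * (t * 2 ^ n)\<rfloor> + 1 \<le> 2 * (nat \<lfloor>t * 2 ^ n\<rfloor> + 1)" by blast
  then have "real (nat \<lfloor>2 * (t * 2 ^ n)\<rfloor> + 1) \<le> 2 * real (nat \<lfloor>t * 2 ^ n\<rfloor> + 1)"
    unfolding of_nat_le_iff[symmetric, where 'a = real] by simp
  then have "real (nat \<lfloor>2 * (t * 2 ^ n)\<rfloor> + 1) / (2 * 2 ^ n) \<le> (2 * real (nat \<lfloor>t * 2 ^ n\<rfloor> + 1)) / (2 * 2 ^ n)"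
    by (intro divide_right_mono) auto
  also have "\<dots> = dyadic_above n t"
    unfolding dyadic_above_def by (intro mult_divide_mult_cancel_left) simp
  finally show ?thesis
    by (simp add: dyadic_above_def mult.left_commute)
qed

text \<open>The right-hand side compares \<open>t\<close> with the largest grid point not exceeding
  \<open>u\<close>. In this form the rounding of a stopping time is seen to be a stopping
  time.\<close>

lemma dyadic_above_le_iff:
  assumes "0 \<le> t"
  shows "dyadic_above n t \<le> u \<longleftrightarrow> t < real_of_int \<lfloor>u * 2 ^ n\<rfloor> / 2 ^ n"
proof -
  have "0 \<le> t * 2 ^ n" using assms by simp
  have "dyadic_above n t \<le> u \<longleftrightarrow> real (nat \<lfloor>t * 2 ^ n\<rfloor> + 1) \<le> u * 2 ^ n"
    by (simp add: dyadic_above_def divide_le_eq)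
  also have "real (nat \<lfloor>t * 2 ^ n\<rfloor> + 1) = real_of_int (\<lfloor>t * 2 ^ n\<rfloor> + 1)"
    using \<open>0 \<le> t * 2 ^ n\<close> by simp
  also have "\<dots> \<le> u * 2 ^ n \<longleftrightarrow> \<lfloor>t * 2 ^ n\<rfloor> + 1 \<le> \<lfloor>u * 2 ^ n\<rfloor>"
    by (simp only: le_floor_iff)
  also have "\<dots> \<longleftrightarrow> t * 2 ^ n < real_of_int \<lfloor>u * 2 ^ n\<rfloor>"
    by (simp add: floor_less_iff add1_zle_eq)
  finally show ?thesis by (simp add: less_divide_eq)
qed

lemma dyadic_above_tendsto:
  assumes "0 \<le> t" shows "(\<lambda>n. dyadic_above n t) \<longlonglongrightarrow> t"
proof (rule tendsto_sandwich)
  show "\<forall>\<^sub>F n in sequentially. t \<le> dyadic_above n t"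
    using dyadic_above_greater by (simp add: less_imp_le)
  show "\<forall>\<^sub>F n in sequentially. dyadic_above n t \<le> t + 1 / 2 ^ n"
    using dyadic_above_le[OF assms] by simp
  show "(\<lambda>n. t + 1 / 2 ^ n) \<longlonglongrightarrow> t"
    using tendsto_add[OF tendsto_const LIMSEQ_divide_realpow_zero[of 2 1], of t] by simp
qed simp

lemma filterlim_dyadic_above:
  "0 \<le> t \<Longrightarrow> filterlim (\<lambda>n. dyadic_above n t) (at t within nonneg_dyadics \<inter> {t<..}) sequentially"
  using dyadic_above_tendsto dyadic_above_dyadic dyadic_above_greater
  by (auto simp: filterlim_at less_imp_neq[symmetric])

lemma at_within_dyadics_neq_bot: "0 \<le> t \<Longrightarrow> at t within nonneg_dyadics \<inter> {t<..} \<noteq> bot"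
  using filterlim_dyadic_above[of t] by (auto simp: filterlim_def bot_unique filtermap_bot_iff)

definition dyadic_right_limit :: "(real \<Rightarrow> real) \<Rightarrow> real \<Rightarrow> real" where
  "dyadic_right_limit v t = Lim (at t within nonneg_dyadics \<inter> {t<..}) v"

lemma tendsto_dyadic_right_limit:
  assumes v: "finite_upcrossings v" "\<And>d. d \<in> nonneg_dyadics \<Longrightarrow> \<bar>v d\<bar> \<le> C" and "0 \<le> t"
  shows "(v \<longlongrightarrow> dyadic_right_limit v t) (at t within nonneg_dyadics \<inter> {t<..})"
  using dyadic_one_sided_limits(1)[OF v, of t] tendsto_Lim[OF at_within_dyadics_neq_bot[OF \<open>0 \<le> t\<close>]]
  unfolding dyadic_right_limit_def by fastforce

lemma dyadic_above_tendsto_right_limit: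
  assumes v: "finite_upcrossings v" "\<And>d. d \<in> nonneg_dyadics \<Longrightarrow> \<bar>v d\<bar> \<le> C" and "0 \<le> t"
  shows "(\<lambda>n. v (dyadic_above n t)) \<longlonglongrightarrow> dyadic_right_limit v t"
  using filterlim_compose[OF tendsto_dyadic_right_limit[OF assms] filterlim_dyadic_above[OF \<open>0 \<le> t\<close>]] .

lemma abs_dyadic_right_limit_le:
  assumes v: "finite_upcrossings v" "\<And>d. d \<in> nonneg_dyadics \<Longrightarrow> \<bar>v d\<bar> \<le> C" and "0 \<le> t"
  shows "\<bar>dyadic_right_limit v t\<bar> \<le> C"
  using tendsto_rabs[OF dyadic_above_tendsto_right_limit[OF assms]] v(2)[OF dyadic_above_dyadic]
  by (intro LIMSEQ_le_const2) auto

text \<open>A closed bound on dyadic values just after \<open>u\<close> passes to the right limit at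
  \<open>u\<close>. It transfers estimates from dyadic times to all times, both for right continuity
  and for left limits.\<close>

lemma dyadic_right_limit_near:
  assumes v: "finite_upcrossings v" "\<And>d. d \<in> nonneg_dyadics \<Longrightarrow> \<bar>v d\<bar> \<le> C"
    and "0 \<le> u" "u < r" and near: "\<And>d. d \<in> nonneg_dyadics \<Longrightarrow> u < d \<Longrightarrow> d < r \<Longrightarrow> dist (v d) l \<le> e"
  shows "dist (dyadic_right_limit v u) l \<le> e"
proof (rule tendsto_upperbound)
  show "((\<lambda>d. dist (v d) l) \<longlongrightarrow> dist (dyadic_right_limit v u) l) (at u within nonneg_dyadics \<inter> {u<..})"
    by (intro tendsto_intros tendsto_dyadic_right_limit[OF v \<open>0 \<le> u\<close>])
  show "\<forall>\<^sub>F d in at u within nonneg_dyadics \<inter> {u<..}. dist (v d) l \<le> e"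
    unfolding eventually_at using \<open>u < r\<close> near
    by (intro exI[of _ "r - u"]) (auto simp: dist_real_def)
qed (rule at_within_dyadics_neq_bot[OF \<open>0 \<le> u\<close>])

lemma cadlag_const: "cadlag (\<lambda>_. c)"
  by (auto simp: cadlag_def)

lemma cadlag_dyadic_right_limit:
  assumes v: "finite_upcrossings v" "\<And>d. d \<in> nonneg_dyadics \<Longrightarrow> \<bar>v d\<bar> \<le> C"
  shows "cadlag (dyadic_right_limit v)"
  unfolding cadlag_def
proof (intro conjI allI impI)
  fix t :: real assume t: "0 \<le> t"
  have "(dyadic_right_limit v \<longlongrightarrow> dyadic_right_limit v t) (at_right t)"
  proof (rule tendstoI)
    fix e :: real assume "0 < e"
    then have "\<forall>\<^sub>F d in at t within nonneg_dyadics \<inter> {t<..}. dist (v d) (dyadic_right_limit v t) < e / 2"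
      by (intro tendstoD[OF tendsto_dyadic_right_limit[OF v t]]) auto
    then obtain r where r: "0 < r" "\<And>d. d \<in> nonneg_dyadics \<Longrightarrow> t < d \<Longrightarrow> d < t + r \<Longrightarrow> dist (v d) (dyadic_right_limit v t) < e / 2"
      by (auto simp: eventually_at dist_real_def)
    have "dist (dyadic_right_limit v u) (dyadic_right_limit v t) < e" if "t < u" "u < t + r" for u
    proof -
      have "dist (dyadic_right_limit v u) (dyadic_right_limit v t) \<le> e / 2"
        using that t r by (intro dyadic_right_limit_near[OF v, of _ "t + r"]) (auto intro: less_imp_le)
      then show ?thesis using \<open>0 < e\<close> by simp
    qed
    then show "\<forall>\<^sub>F u in at_right t. dist (dyadic_right_limit v u) (dyadic_right_limit v t) < e"
      unfolding eventually_at using r(1) by (intro exI[of _ r]) (auto simp: dist_real_def)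
  qed
  then show "continuous (at_right t) (dyadic_right_limit v)"
    by (simp add: continuous_within)
next
  fix t :: real assume t: "0 < t"
  obtain l where l: "(v \<longlongrightarrow> l) (at t within nonneg_dyadics \<inter> {..<t})"
    using dyadic_one_sided_limits(2)[OF v, of t] by blast
  have "(dyadic_right_limit v \<longlongrightarrow> l) (at_left t)"
  proof (rule tendstoI)
    fix e :: real assume "0 < e"
    then have "\<forall>\<^sub>F d in at t within nonneg_dyadics \<inter> {..<t}. dist (v d) l < e / 2"
      by (intro tendstoD[OF l]) auto
    then obtain r where r: "0 < r" "\<And>d. d \<in> nonneg_dyadics \<Longrightarrow> d < t \<Longrightarrow> t - r < d \<Longrightarrow> dist (v d) l < e / 2"
      by (auto simp: eventually_at dist_real_def)
    have "dist (dyadic_right_limit v u) l < e" if "u < t" "t - r < u" "0 \<le> u" for u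
    proof -
      have "dist (dyadic_right_limit v u) l \<le> e / 2"
        using that t r by (intro dyadic_right_limit_near[OF v, of _ t]) (auto intro: less_imp_le)
      then show ?thesis using \<open>0 < e\<close> by simp
    qed
    then show "\<forall>\<^sub>F u in at_left t. dist (dyadic_right_limit v u) l < e"
      \<comment> \<open>The radius \<open>min r t\<close> keeps \<open>u\<close> nonnegative, where
        right limits are known to exist.\<close>
      unfolding eventually_at using r(1) t by (intro exI[of _ "min r t"]) (auto simp: dist_real_def)
  qed
  then show "\<exists>l. (dyadic_right_limit v \<longlongrightarrow> l) (at_left t)" by blast
qed

subsection \<open>Conditional risk at stopping times\<close>

lemma Linf_mono:
  "space G = space H \<Longrightarrow> sets G \<subseteq> sets H \<Longrightarrow> X \<in> Linf M G \<Longrightarrow> X \<in> Linf M H"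
  by (auto simp: Linf_def measurable_def)

lemma Linf_const [simp]: "(\<lambda>_. c) \<in> Linf M G"
  by (auto simp: Linf_def)

lemma Linf_uminus: "X \<in> Linf M G \<Longrightarrow> (\<lambda>\<omega>. - X \<omega>) \<in> Linf M G"
  by (auto simp: Linf_def)

lemma Linf_add:
  assumes "X \<in> Linf M G" "Y \<in> Linf M G"
  shows "(\<lambda>\<omega>. X \<omega> + Y \<omega>) \<in> Linf M G"
proof -
  obtain C D where "AE \<omega> in M. \<bar>X \<omega>\<bar> \<le> C" "AE \<omega> in M. \<bar>Y \<omega>\<bar> \<le> D"
    using assms by (auto simp: Linf_def)
  then have "AE \<omega> in M. \<bar>X \<omega> + Y \<omega>\<bar> \<le> C + D"
    by eventually_elim linarith
  then show ?thesis
    using assms by (auto simp: Linf_def)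
qed

lemma Linf_indicator_mult:
  assumes "A \<in> sets G" "X \<in> Linf M G"
  shows "(\<lambda>\<omega>. indicator A \<omega> * X \<omega>) \<in> Linf M G"
proof -
  obtain C where C: "AE \<omega> in M. \<bar>X \<omega>\<bar> \<le> C"
    using assms by (auto simp: Linf_def)
  then have "AE \<omega> in M. \<bar>indicator A \<omega> * X \<omega>\<bar> \<le> max 0 C"
    by eventually_elim (auto simp: indicator_def)
  then show ?thesis
    using assms by (auto simp: Linf_def)
qed

section \<open>Sigma-algebras at stopping times\<close>

context filtered_prob_space
begin

lemma sets_F_infinity: "sets (F \<top>) = sets M"
  using sets_F_top by simp

lemma sets_sigma_at_subset: "stopping_time F \<sigma> \<Longrightarrow> sets (sigma_at M F \<sigma>) \<subseteq> sets M"
  using sets_pre_sigmaD[of \<sigma> _ \<top>] by (auto simp: sets_F_infinity)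

lemma subalgebra_sigma_at: "stopping_time F \<sigma> \<Longrightarrow> subalgebra M (sigma_at M F \<sigma>)"
  by (simp add: subalgebra_def space_pre_sigma sets_sigma_at_subset)

lemma sets_sigma_at_const: "sets (sigma_at M F (\<lambda>_. t)) = sets (F t)"
proof
  show "sets (sigma_at M F (\<lambda>_. t)) \<subseteq> sets (F t)"
    using sets_pre_sigmaD[OF stopping_time_const, of _ t t] by auto
  show "sets (F t) \<subseteq> sets (sigma_at M F (\<lambda>_. t))"
  proof
    fix A assume A: "A \<in> sets (F t)"
    show "A \<in> sets (sigma_at M F (\<lambda>_. t))"
    proof (rule sets_pre_sigmaI[OF stopping_time_const])
      fix u
      show "{\<omega> \<in> A. t \<le> u} \<in> sets (F u)"
        using A sets_F_mono[of t u] by (cases "t \<le> u") auto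
    qed
  qed
qed

lemma null_sets_in_F: "A \<in> null_sets M \<Longrightarrow> A \<in> sets (F t)"
  using sets_F_mono[of 0 t] sets_F_0 by auto

lemma stopping_time_measurable: "stopping_time F \<sigma> \<Longrightarrow> \<sigma> \<in> borel_measurable M"
  by (rule measurable_stopping_time[of F]) (use sets_F_mono[of _ \<top>] in \<open>auto simp: sets_F_infinity space_F\<close>)

lemma null_sets_in_sigma_at:
  assumes "stopping_time F \<sigma>" "A \<in> null_sets M"
  shows "A \<in> sets (sigma_at M F \<sigma>)"
proof (rule sets_pre_sigmaI[OF assms(1)])
  fix t
  have "{\<omega> \<in> space M. \<sigma> \<omega> \<le> t} \<in> sets M"
    using stopping_time_measurable[OF assms(1)] by measurable
  then have "A \<inter> {\<omega> \<in> space M. \<sigma> \<omega> \<le> t} \<in> null_sets M"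
    by (intro null_set_Int2 assms(2))
  also have "A \<inter> {\<omega> \<in> space M. \<sigma> \<omega> \<le> t} = {\<omega> \<in> A. \<sigma> \<omega> \<le> t}"
    using assms(2) sets.sets_into_space by auto
  finally show "{\<omega> \<in> A. \<sigma> \<omega> \<le> t} \<in> sets (F t)"
    by (rule null_sets_in_F)
qed

text \<open>Preimages under \<open>f\<close> and \<open>g\<close> differ only inside the null set
  \<open>E\<close>. The part inside \<open>E\<close> is null and measurable for \<open>M\<close>,
  hence belongs to the sigma-algebra at \<open>\<sigma>\<close>, which contains all null sets of
  \<open>M\<close>.\<close>

lemma measurable_sigma_at_AE_cong:
  assumes \<sigma>: "stopping_time F \<sigma>"
    and f: "f \<in> borel_measurable (sigma_at M F \<sigma>)" and g[measurable]: "g \<in> borel_measurable M"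
    and eq: "AE \<omega> in M. f \<omega> = (g \<omega> :: real)"
  shows "g \<in> borel_measurable (sigma_at M F \<sigma>)"
proof (rule measurableI)
  have [measurable]: "f \<in> borel_measurable M"
    using measurable_from_subalg[OF subalgebra_sigma_at[OF \<sigma>] f] .
  define E where "E = {\<omega> \<in> space M. f \<omega> \<noteq> g \<omega>}"
  have "E \<in> null_sets M"
    using eq unfolding E_def by (intro AE_iff_null[THEN iffD1]) auto
  fix B :: "real set" assume B[measurable]: "B \<in> sets borel"
  have "E \<inter> (g -` B \<inter> space M) \<in> null_sets M"
    using \<open>E \<in> null_sets M\<close> by (intro null_set_Int2) auto
  then have "(f -` B \<inter> space (sigma_at M F \<sigma>)) - E \<union> (E \<inter> (g -` B \<inter> space M)) \<in> sets (sigma_at M F \<sigma>)"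
    using f B \<open>E \<in> null_sets M\<close> \<sigma> by (intro sets.Un sets.Diff measurable_sets null_sets_in_sigma_at)
  also have "(f -` B \<inter> space (sigma_at M F \<sigma>)) - E \<union> (E \<inter> (g -` B \<inter> space M)) = g -` B \<inter> space (sigma_at M F \<sigma>)"
    by (auto simp: E_def space_pre_sigma)
  finally show "g -` B \<inter> space (sigma_at M F \<sigma>) \<in> sets (sigma_at M F \<sigma>)" .
qed simp

text \<open>Right continuity of the filtration extends from fixed times to stopping times: for every
  \<open>u > t\<close> the event is written through the \<open>s n\<close> inside
  \<open>F u\<close>, and the intersection over \<open>u\<close> is \<open>F t\<close>.\<close>

lemma sets_sigma_at_right_limit:
  assumes \<sigma>: "stopping_time F \<sigma>" and s: "\<And>n. stopping_time F (s n)"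
    and le: "\<And>n \<omega>. \<omega> \<in> space M \<Longrightarrow> \<sigma> \<omega> \<le> s n \<omega>"
    and lim: "\<And>\<omega>. \<omega> \<in> space M \<Longrightarrow> (\<lambda>n. s n \<omega>) \<longlonglongrightarrow> \<sigma> \<omega>"
    and A: "\<And>n. A \<in> sets (sigma_at M F (s n))"
  shows "A \<in> sets (sigma_at M F \<sigma>)"
proof (rule sets_pre_sigmaI[OF \<sigma>])
  have A_M: "A \<in> sets M" using A[of 0] sets_sigma_at_subset[OF s] by blast
  fix t :: ennreal
  show "{\<omega> \<in> A. \<sigma> \<omega> \<le> t} \<in> sets (F t)"
  proof (cases "t < \<infinity>")
    case False
    then have "t = \<infinity>" by (simp add: not_less top_unique)
    then show ?thesis using A_M by (simp add: sets_F_infinity)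
  next
    case True
    have "{\<omega> \<in> A. \<sigma> \<omega> \<le> t} \<in> sets (F u)" if u: "t < u" for u
    proof -
      obtain x :: "nat \<Rightarrow> ennreal" where x: "\<And>k. t < x k" "x \<longlonglongrightarrow> t"
        using approx_from_above_dense_linorder[OF True] by blast
      \<comment> \<open>The levels \<open>x k\<close> tend to \<open>t\<close> from above and force
        \<open>\<sigma> \<omega> \<le> t\<close>; the minimum with \<open>u\<close> keeps every
        event in \<open>F u\<close>.\<close>
      have "{\<omega> \<in> A. \<sigma> \<omega> \<le> t} = (\<Inter>k. \<Union>n. {\<omega> \<in> A. s n \<omega> \<le> min (x k) u})"
      proof (intro set_eqI iffI)
        fix \<omega> assume \<omega>: "\<omega> \<in> {\<omega> \<in> A. \<sigma> \<omega> \<le> t}"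
        then have sp: "\<omega> \<in> space M" using A_M sets.sets_into_space by auto
        have "\<exists>n. s n \<omega> \<le> min (x k) u" for k
        proof -
          have "\<sigma> \<omega> < min (x k) u" using \<omega> x(1) u by (auto intro: le_less_trans)
          from order_tendstoD(2)[OF lim[OF sp] this] show ?thesis
            by (auto simp: eventually_sequentially intro: less_imp_le)
        qed
        then show "\<omega> \<in> (\<Inter>k. \<Union>n. {\<omega> \<in> A. s n \<omega> \<le> min (x k) u})" using \<omega> by auto
      next
        fix \<omega> assume \<omega>: "\<omega> \<in> (\<Inter>k. \<Union>n. {\<omega> \<in> A. s n \<omega> \<le> min (x k) u})"
        then have "\<omega> \<in> A" by auto
        then have sp: "\<omega> \<in> space M" using A_M sets.sets_into_space by auto
        have "\<sigma> \<omega> \<le> x k" for k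
        proof -
          obtain n where "s n \<omega> \<le> min (x k) u" using \<omega> by auto
          then show ?thesis using le[OF sp, of n] by (auto intro: order_trans)
        qed
        then have "\<sigma> \<omega> \<le> t" using x(2) by (intro LIMSEQ_le_const) auto
        with \<open>\<omega> \<in> A\<close> show "\<omega> \<in> {\<omega> \<in> A. \<sigma> \<omega> \<le> t}" by simp
      qed
      also have "\<dots> \<in> sets (F u)"
      proof -
        have "{\<omega> \<in> A. s n \<omega> \<le> min (x k) u} \<in> sets (F u)" for n k
          using sets_pre_sigmaD[OF s A, of n "min (x k) u"] sets_F_mono[of "min (x k) u" u] by auto
        then show ?thesis by (intro sets.countable_INT sets.countable_UN) auto
      qed
      finally show ?thesis .
    qed
    then show ?thesis
      using right_continuous[OF True] by auto
  qed
qed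

end

text \<open>Here \<open>r \<sigma>\<close> stands for the risk at \<open>\<sigma>\<close> of
  positions with terminal time infinity. Time consistency appears as \<open>risk_tower\<close>, in
  which the intermediate position is again evaluated up to infinity, so that a single family of maps
  suffices.\<close>

locale risk_process = filtered_prob_space M F
  for M :: "'a measure" and F :: "ennreal \<Rightarrow> 'a measure" +
  fixes r :: "('a \<Rightarrow> ennreal) \<Rightarrow> ('a \<Rightarrow> real) \<Rightarrow> 'a \<Rightarrow> real"
  assumes risk_Linf: "\<And>\<sigma> X. stopping_time F \<sigma> \<Longrightarrow> X \<in> Linf M M \<Longrightarrow> r \<sigma> X \<in> Linf M (sigma_at M F \<sigma>)"
    and risk_mono: "\<And>\<sigma> X Y. stopping_time F \<sigma> \<Longrightarrow> X \<in> Linf M M \<Longrightarrow> Y \<in> Linf M M \<Longrightarrow>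
      AE \<omega> in M. X \<omega> \<le> Y \<omega> \<Longrightarrow> AE \<omega> in M. r \<sigma> Y \<omega> \<le> r \<sigma> X \<omega>"
    and risk_add: "\<And>\<sigma> X Z. stopping_time F \<sigma> \<Longrightarrow> X \<in> Linf M M \<Longrightarrow> Z \<in> Linf M (sigma_at M F \<sigma>) \<Longrightarrow>
      AE \<omega> in M. r \<sigma> (\<lambda>\<omega>. X \<omega> + Z \<omega>) \<omega> = r \<sigma> X \<omega> - Z \<omega>"
    and risk_zero: "\<And>\<sigma>. stopping_time F \<sigma> \<Longrightarrow> AE \<omega> in M. r \<sigma> (\<lambda>_. 0) \<omega> = 0"
    and risk_decseq: "\<And>\<sigma> X Xn. stopping_time F \<sigma> \<Longrightarrow> X \<in> Linf M M \<Longrightarrow> (\<And>n::nat. Xn n \<in> Linf M M) \<Longrightarrow>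
      AE \<omega> in M. decseq (\<lambda>n. Xn n \<omega>) \<Longrightarrow> AE \<omega> in M. (\<lambda>n. Xn n \<omega>) \<longlonglongrightarrow> X \<omega> \<Longrightarrow>
      AE \<omega> in M. (\<lambda>n. r \<sigma> (Xn n) \<omega>) \<longlonglongrightarrow> r \<sigma> X \<omega>"
    and risk_tower: "\<And>\<nu> \<sigma> X. stopping_time F \<nu> \<Longrightarrow> stopping_time F \<sigma> \<Longrightarrow> (\<And>\<omega>. \<omega> \<in> space M \<Longrightarrow> \<nu> \<omega> \<le> \<sigma> \<omega>) \<Longrightarrow>
      X \<in> Linf M M \<Longrightarrow> AE \<omega> in M. r \<nu> (\<lambda>\<omega>. - r \<sigma> X \<omega>) \<omega> = r \<nu> X \<omega>"
begin

section \<open>Consequences of monotonicity, translation invariance and time consistency\<close>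

lemma Linf_sigma_at: "stopping_time F \<sigma> \<Longrightarrow> X \<in> Linf M (sigma_at M F \<sigma>) \<Longrightarrow> X \<in> Linf M M"
  by (rule Linf_mono[OF space_pre_sigma sets_sigma_at_subset])

lemma risk_Linf_M: "stopping_time F \<sigma> \<Longrightarrow> X \<in> Linf M M \<Longrightarrow> r \<sigma> X \<in> Linf M M"
  using risk_Linf Linf_sigma_at by blast

lemma risk_measurable: "stopping_time F \<sigma> \<Longrightarrow> X \<in> Linf M M \<Longrightarrow> r \<sigma> X \<in> borel_measurable (sigma_at M F \<sigma>)"
  using risk_Linf by (auto simp: Linf_def)

lemma risk_cong:
  assumes "stopping_time F \<sigma>" "X \<in> Linf M M" "Y \<in> Linf M M" "AE \<omega> in M. X \<omega> = Y \<omega>"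
  shows "AE \<omega> in M. r \<sigma> X \<omega> = r \<sigma> Y \<omega>"
proof -
  have "AE \<omega> in M. r \<sigma> Y \<omega> \<le> r \<sigma> X \<omega>" "AE \<omega> in M. r \<sigma> X \<omega> \<le> r \<sigma> Y \<omega>"
    by (intro risk_mono assms(1-3) eventually_mono[OF assms(4)]; simp)+
  then show ?thesis by eventually_elim simp
qed

lemma risk_known:
  assumes "stopping_time F \<sigma>" "Z \<in> Linf M (sigma_at M F \<sigma>)"
  shows "AE \<omega> in M. r \<sigma> Z \<omega> = - Z \<omega>"
  using risk_add[OF assms(1) Linf_const assms(2), of 0] risk_zero[OF assms(1)]
  by eventually_elim simp

lemma risk_bounded:
  assumes "stopping_time F \<sigma>" "X \<in> Linf M M" "AE \<omega> in M. \<bar>X \<omega>\<bar> \<le> C"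
  shows "AE \<omega> in M. \<bar>r \<sigma> X \<omega>\<bar> \<le> C"
proof -
  have "AE \<omega> in M. r \<sigma> (\<lambda>_. C) \<omega> \<le> r \<sigma> X \<omega>" "AE \<omega> in M. r \<sigma> X \<omega> \<le> r \<sigma> (\<lambda>_. - C) \<omega>"
    by (intro risk_mono assms(1,2) Linf_const eventually_mono[OF assms(3)]; simp)+
  moreover have "AE \<omega> in M. r \<sigma> (\<lambda>_. C) \<omega> = - C" "AE \<omega> in M. r \<sigma> (\<lambda>_. - C) \<omega> = C"
    using risk_known[OF assms(1) Linf_const, of C] risk_known[OF assms(1) Linf_const, of "- C"] by simp_all
  ultimately show ?thesis by eventually_elim linarith
qed

text \<open>On \<open>A\<close> the position is squeezed between \<open>X\<close> plus and minus
  \<open>C\<close> times the indicator of the complement, a translation that vanishes on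
  \<open>A\<close>. Off \<open>A\<close> it is squeezed between multiples of the indicator of
  \<open>A\<close>, whose risk vanishes there.\<close>

lemma risk_local:
  assumes \<sigma>: "stopping_time F \<sigma>" and A: "A \<in> sets (sigma_at M F \<sigma>)" and X: "X \<in> Linf M M"
  shows "AE \<omega> in M. r \<sigma> (\<lambda>\<omega>. indicator A \<omega> * X \<omega>) \<omega> = indicator A \<omega> * r \<sigma> X \<omega>"
proof -
  obtain C where C: "AE \<omega> in M. \<bar>X \<omega>\<bar> \<le> C" using X by (auto simp: Linf_def)
  have A_M: "A \<in> sets M" using sets_sigma_at_subset[OF \<sigma>] A by auto
  have AX: "(\<lambda>\<omega>. indicator A \<omega> * X \<omega>) \<in> Linf M M"
    by (rule Linf_indicator_mult[OF A_M X])
  have on: "(\<lambda>\<omega>. indicator A \<omega> * c) \<in> Linf M (sigma_at M F \<sigma>)" for c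
    by (intro Linf_indicator_mult A Linf_const)
  have off: "(\<lambda>\<omega>. indicator (space M - A) \<omega> * c) \<in> Linf M (sigma_at M F \<sigma>)" for c
    using sets.compl_sets[OF A] by (intro Linf_indicator_mult Linf_const) (simp add: space_pre_sigma)
  note onM = Linf_sigma_at[OF \<sigma> on] and offM = Linf_sigma_at[OF \<sigma> off]
  have C': "AE \<omega> in M. \<bar>X \<omega>\<bar> \<le> C \<and> \<omega> \<in> space M" using C by simp
  have "AE \<omega> in M. r \<sigma> (\<lambda>\<omega>. X \<omega> + indicator (space M - A) \<omega> * C) \<omega> \<le> r \<sigma> (\<lambda>\<omega>. indicator A \<omega> * X \<omega>) \<omega>"
    by (intro risk_mono \<sigma> AX Linf_add X offM eventually_mono[OF C']) (auto simp: indicator_def)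
  moreover have "AE \<omega> in M. r \<sigma> (\<lambda>\<omega>. indicator A \<omega> * X \<omega>) \<omega> \<le> r \<sigma> (\<lambda>\<omega>. X \<omega> + indicator (space M - A) \<omega> * (- C)) \<omega>"
    by (intro risk_mono \<sigma> AX Linf_add X offM eventually_mono[OF C']) (auto simp: indicator_def)
  moreover have "AE \<omega> in M. r \<sigma> (\<lambda>\<omega>. indicator A \<omega> * C) \<omega> \<le> r \<sigma> (\<lambda>\<omega>. indicator A \<omega> * X \<omega>) \<omega>"
    by (intro risk_mono \<sigma> AX onM eventually_mono[OF C']) (auto simp: indicator_def)
  moreover have "AE \<omega> in M. r \<sigma> (\<lambda>\<omega>. indicator A \<omega> * X \<omega>) \<omega> \<le> r \<sigma> (\<lambda>\<omega>. indicator A \<omega> * (- C)) \<omega>"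
    by (intro risk_mono \<sigma> AX onM eventually_mono[OF C']) (auto simp: indicator_def)
  ultimately show ?thesis
    using risk_add[OF \<sigma> X off, of C] risk_add[OF \<sigma> X off, of "- C"]
      risk_known[OF \<sigma> on, of C] risk_known[OF \<sigma> on, of "- C"] AE_space
  proof eventually_elim
    case (elim \<omega>)
    then show ?case by (cases "\<omega> \<in> A") auto
  qed
qed

text \<open>Where the two times agree, the position \<open>- r \<sigma> X\<close> is already known
  at \<open>\<nu>\<close>, so its risk at \<open>\<nu>\<close> is \<open>r \<sigma> X\<close> by
  locality; by the tower property it is also \<open>r \<nu> X\<close>.\<close>

lemma risk_eq_on_eq_ordered:
  assumes \<nu>: "stopping_time F \<nu>" and \<sigma>: "stopping_time F \<sigma>"
    and le: "\<And>\<omega>. \<omega> \<in> space M \<Longrightarrow> \<nu> \<omega> \<le> \<sigma> \<omega>" and X: "X \<in> Linf M M"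
  shows "AE \<omega> in M. \<nu> \<omega> = \<sigma> \<omega> \<longrightarrow> r \<nu> X \<omega> = r \<sigma> X \<omega>"
proof -
  define B where "B = {\<omega> \<in> space M. \<nu> \<omega> = \<sigma> \<omega>}"
  have "{\<omega> \<in> space M. \<nu> \<omega> < \<sigma> \<omega>} \<in> sets (sigma_at M F \<nu>)"
    using stopping_time_less[OF \<nu> \<sigma>] by (simp add: pred_def space_pre_sigma)
  from sets.compl_sets[OF this] have "space M - {\<omega> \<in> space M. \<nu> \<omega> < \<sigma> \<omega>} \<in> sets (sigma_at M F \<nu>)"
    by (simp add: space_pre_sigma)
  also have "space M - {\<omega> \<in> space M. \<nu> \<omega> < \<sigma> \<omega>} = B"
    using le by (fastforce simp: B_def)
  finally have B: "B \<in> sets (sigma_at M F \<nu>)" .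
  \<comment> \<open>On \<open>B\<close> the events \<open>\<sigma> \<omega> \<le> t\<close> and
    \<open>\<nu> \<omega> \<le> t\<close> coincide, so both sigma-algebras have the same trace
    there.\<close>
  have trace: "D \<inter> B \<in> sets (sigma_at M F \<nu>)" if D: "D \<in> sets (sigma_at M F \<sigma>)" for D
  proof (rule sets_pre_sigmaI[OF \<nu>])
    fix t
    have "{\<omega> \<in> D. \<sigma> \<omega> \<le> t} \<inter> {\<omega> \<in> B. \<nu> \<omega> \<le> t} \<in> sets (F t)"
      by (intro sets.Int sets_pre_sigmaD[OF \<nu> B] sets_pre_sigmaD[OF \<sigma> D])
    also have "{\<omega> \<in> D. \<sigma> \<omega> \<le> t} \<inter> {\<omega> \<in> B. \<nu> \<omega> \<le> t} = {\<omega> \<in> D \<inter> B. \<nu> \<omega> \<le> t}"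
      by (auto simp: B_def)
    finally show "{\<omega> \<in> D \<inter> B. \<nu> \<omega> \<le> t} \<in> sets (F t)" .
  qed
  have meas: "(\<lambda>\<omega>. indicator B \<omega> * - r \<sigma> X \<omega>) \<in> borel_measurable (sigma_at M F \<nu>)"
  proof (rule measurableI)
    fix S :: "real set" assume S: "S \<in> sets borel"
    have "(\<lambda>\<omega>. - r \<sigma> X \<omega>) -` S \<inter> space (sigma_at M F \<sigma>) \<in> sets (sigma_at M F \<sigma>)"
      using S by (intro measurable_sets[OF borel_measurable_uminus[OF risk_measurable[OF \<sigma> X]]])
    \<comment> \<open>Off \<open>B\<close> the function is zero, so the complement of
      \<open>B\<close> is added exactly when \<open>S\<close> contains \<open>0\<close>.\<close>
    then have "((\<lambda>\<omega>. - r \<sigma> X \<omega>) -` S \<inter> space M \<inter> B) \<union> (if 0 \<in> S then space (sigma_at M F \<nu>) - B else {}) \<in> sets (sigma_at M F \<nu>)"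
      using sets.compl_sets[OF B] by (intro sets.Un trace) (auto simp: space_pre_sigma)
    also have "((\<lambda>\<omega>. - r \<sigma> X \<omega>) -` S \<inter> space M \<inter> B) \<union> (if 0 \<in> S then space (sigma_at M F \<nu>) - B else {}) =
        (\<lambda>\<omega>. indicator B \<omega> * - r \<sigma> X \<omega>) -` S \<inter> space (sigma_at M F \<nu>)"
      by (auto simp: space_pre_sigma B_def split: if_splits split_indicator split_indicator_asm)
    finally show "(\<lambda>\<omega>. indicator B \<omega> * - r \<sigma> X \<omega>) -` S \<inter> space (sigma_at M F \<nu>) \<in> sets (sigma_at M F \<nu>)" .
  qed simp
  have neg: "(\<lambda>\<omega>. - r \<sigma> X \<omega>) \<in> Linf M M"
    by (intro Linf_uminus risk_Linf_M \<sigma> X)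
  have "B \<in> sets M" using B sets_sigma_at_subset[OF \<nu>] by auto
  from Linf_indicator_mult[OF this neg] meas
  have "(\<lambda>\<omega>. indicator B \<omega> * - r \<sigma> X \<omega>) \<in> Linf M (sigma_at M F \<nu>)"
    by (auto simp: Linf_def)
  note known = risk_known[OF \<nu> this]
  have "AE \<omega> in M. r \<nu> (\<lambda>\<omega>. - r \<sigma> X \<omega>) \<omega> = r \<nu> X \<omega>"
    by (rule risk_tower[OF \<nu> \<sigma> le X])
  with known risk_local[OF \<nu> B neg] AE_space show ?thesis
    by eventually_elim (auto simp: B_def)
qed

text \<open>The minimum of the two times is below both and equals both where they agree, which
  reduces the claim to ordered times.\<close>

lemma risk_eq_on_eq:
  assumes \<sigma>: "stopping_time F \<sigma>" and \<tau>: "stopping_time F \<tau>" and X: "X \<in> Linf M M"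
  shows "AE \<omega> in M. \<sigma> \<omega> = \<tau> \<omega> \<longrightarrow> r \<sigma> X \<omega> = r \<tau> X \<omega>"
proof -
  define \<nu> where "\<nu> = (\<lambda>\<omega>. min (\<sigma> \<omega>) (\<tau> \<omega>))"
  have \<nu>: "stopping_time F \<nu>" unfolding \<nu>_def by (rule stopping_time_min[OF \<sigma> \<tau>])
  have "AE \<omega> in M. \<nu> \<omega> = \<sigma> \<omega> \<longrightarrow> r \<nu> X \<omega> = r \<sigma> X \<omega>" "AE \<omega> in M. \<nu> \<omega> = \<tau> \<omega> \<longrightarrow> r \<nu> X \<omega> = r \<tau> X \<omega>"
    by (intro risk_eq_on_eq_ordered \<nu> \<sigma> \<tau> X, simp add: \<nu>_def)+
  then show ?thesis
    by eventually_elim (auto simp: \<nu>_def)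
qed

text \<open>The tail suprema \<open>h n\<close> decrease to \<open>g\<close> and dominate
  \<open>f n\<close>, so their risk is at most \<open>U\<close>; continuity from above passes this
  bound to the limit.\<close>

lemma risk_fatou:
  assumes \<sigma>: "stopping_time F \<sigma>" and f: "\<And>n::nat. f n \<in> Linf M M" and g: "g \<in> borel_measurable M"
    and bound: "\<And>n. AE \<omega> in M. \<bar>f n \<omega>\<bar> \<le> C"
    and lim: "AE \<omega> in M. (\<lambda>n. f n \<omega>) \<longlonglongrightarrow> g \<omega>"
    and U: "\<And>n. AE \<omega> in M. r \<sigma> (f n) \<omega> \<le> U \<omega>"
  shows "AE \<omega> in M. r \<sigma> g \<omega> \<le> U \<omega>"
proof -
  \<comment> \<open>The bound on \<open>f n\<close> holds only almost everywhere; clipping makes the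
    suprema in \<open>h\<close> finite at every point. The absolute value of \<open>C\<close> keeps
    the clipping interval nonempty whatever the sign of \<open>C\<close>.\<close>
  define c where "c n \<omega> = max (- \<bar>C\<bar>) (min \<bar>C\<bar> (f n \<omega>))" for n \<omega>
  define h where "h n \<omega> = (SUP k. c (n + k) \<omega>)" for n \<omega>
  have [measurable]: "f n \<in> borel_measurable M" for n using f by (auto simp: Linf_def)
  have [measurable]: "c n \<in> borel_measurable M" for n unfolding c_def by measurable
  have c_bound: "\<bar>c n \<omega>\<bar> \<le> \<bar>C\<bar>" for n \<omega> by (auto simp: c_def)
  have bdd: "bdd_above (range (\<lambda>k. c (n + k) \<omega>))" for n \<omega>
    using c_bound by (intro bdd_aboveI[of _ "\<bar>C\<bar>"]) (auto simp: abs_le_iff)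
  have c_le_h: "c (n + k) \<omega> \<le> h n \<omega>" for n k \<omega>
    unfolding h_def by (intro cSUP_upper bdd) simp
  have "h n \<in> borel_measurable M" for n
    unfolding h_def by (intro borel_measurable_cSUP bdd) auto
  moreover have h_bound: "\<bar>h n \<omega>\<bar> \<le> \<bar>C\<bar>" for n \<omega>
  proof -
    have "h n \<omega> \<le> \<bar>C\<bar>" unfolding h_def using c_bound by (intro cSUP_least) (auto simp: abs_le_iff)
    then show ?thesis using c_le_h[of n 0 \<omega>] c_bound[of n \<omega>] by auto
  qed
  ultimately have h: "h n \<in> Linf M M" for n by (auto simp: Linf_def intro!: exI[of _ "\<bar>C\<bar>"])
  have all: "AE \<omega> in M. \<forall>n. \<bar>f n \<omega>\<bar> \<le> C" using bound by (simp add: AE_all_countable)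
  have fc: "f n \<omega> = c n \<omega>" if "\<forall>n. \<bar>f n \<omega>\<bar> \<le> C" for n \<omega>
    using that[rule_format, of n] by (auto simp: c_def)
  have "AE \<omega> in M. \<bar>g \<omega>\<bar> \<le> C"
    using all lim by eventually_elim (rule LIMSEQ_le_const2[OF tendsto_rabs], auto)
  with g have gL: "g \<in> Linf M M" by (auto simp: Linf_def)
  have dec: "decseq (\<lambda>n. h n \<omega>)" for \<omega>
    unfolding decseq_Suc_iff
  proof
    fix n show "h (Suc n) \<omega> \<le> h n \<omega>"
      unfolding h_def[of "Suc n"] using c_le_h[of n "Suc _" \<omega>] by (intro cSUP_least) auto
  qed
  have h_lim: "AE \<omega> in M. (\<lambda>n. h n \<omega>) \<longlonglongrightarrow> g \<omega>"
    using all lim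
  proof eventually_elim
    case (elim \<omega>)
    show ?case
    proof (rule LIMSEQ_I)
      fix e :: real assume "0 < e"
      then obtain N where N: "\<And>n. n \<ge> N \<Longrightarrow> \<bar>c n \<omega> - g \<omega>\<bar> < e / 2"
        using LIMSEQ_D[OF elim(2), of "e / 2"] fc[OF elim(1)] by auto
      have "norm (h n \<omega> - g \<omega>) < e" if "n \<ge> N" for n
      proof -
        have "c (n + k) \<omega> \<le> g \<omega> + e / 2" for k using N[of "n + k"] that by linarith
        then have "h n \<omega> \<le> g \<omega> + e / 2" unfolding h_def by (intro cSUP_least) auto
        then show ?thesis using c_le_h[of n 0 \<omega>] N[OF that] \<open>0 < e\<close> by (simp add: abs_if split: if_splits)
      qed
      then show "\<exists>N. \<forall>n\<ge>N. norm (h n \<omega> - g \<omega>) < e" by blast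
    qed
  qed
  have h_le: "AE \<omega> in M. r \<sigma> (h n) \<omega> \<le> r \<sigma> (f n) \<omega>" for n
  proof (rule risk_mono[OF \<sigma> f h])
    show "AE \<omega> in M. f n \<omega> \<le> h n \<omega>"
      using all
    proof eventually_elim
      case (elim \<omega>)
      then show ?case using c_le_h[of n 0 \<omega>] fc[OF elim, of n] by simp
    qed
  qed
  have "AE \<omega> in M. r \<sigma> (h n) \<omega> \<le> U \<omega>" for n
    using h_le[of n] U[of n] by (rule eventually_elim2) simp
  then have "AE \<omega> in M. \<forall>n. r \<sigma> (h n) \<omega> \<le> U \<omega>" by (simp add: AE_all_countable)
  moreover have "AE \<omega> in M. (\<lambda>n. r \<sigma> (h n) \<omega>) \<longlonglongrightarrow> r \<sigma> g \<omega>"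
    using dec h_lim by (intro risk_decseq \<sigma> gL h) auto
  ultimately show ?thesis
    by eventually_elim (rule LIMSEQ_le_const2, auto)
qed

text \<open>Both Fatou bounds need \<open>L\<close> to be known at \<open>\<sigma>\<close>, so that
  it can be treated as cash in \<open>r \<sigma>\<close>. Hence the measurability of
  \<open>L\<close> at \<open>\<sigma>\<close> is shown first, by right continuity of the
  filtration.\<close>

lemma risk_right_continuous:
  assumes \<sigma>: "stopping_time F \<sigma>" and s: "\<And>n::nat. stopping_time F (s n)"
    and le: "\<And>n \<omega>. \<omega> \<in> space M \<Longrightarrow> \<sigma> \<omega> \<le> s n \<omega>"
    and dec: "\<And>n \<omega>. \<omega> \<in> space M \<Longrightarrow> s (Suc n) \<omega> \<le> s n \<omega>"
    and lim: "\<And>\<omega>. \<omega> \<in> space M \<Longrightarrow> (\<lambda>n. s n \<omega>) \<longlonglongrightarrow> \<sigma> \<omega>"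
    and X: "X \<in> Linf M M" and L: "L \<in> borel_measurable M"
    and conv: "AE \<omega> in M. (\<lambda>n. r (s n) X \<omega>) \<longlonglongrightarrow> L \<omega>"
  shows "AE \<omega> in M. r \<sigma> X \<omega> = L \<omega>"
proof -
  obtain C where C: "AE \<omega> in M. \<bar>X \<omega>\<bar> \<le> C" using X by (auto simp: Linf_def)
  have bound: "AE \<omega> in M. \<bar>r (s n) X \<omega>\<bar> \<le> C" for n by (rule risk_bounded[OF s X C])
  \<comment> \<open>A version of \<open>L\<close> defined everywhere. A limit superior ignores the
    first \<open>m\<close> terms, and all later ones are measurable at \<open>s m\<close>; this
    holds for every \<open>m\<close>.\<close>
  define L' where "L' \<omega> = real_of_ereal (limsup (\<lambda>n. ereal (r (s n) X \<omega>)))" for \<omega>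
  have "L' \<in> borel_measurable (sigma_at M F (s m))" for m
  proof -
    have "sets (sigma_at M F (s (n + m))) \<subseteq> sets (sigma_at M F (s m))" for n
    proof (rule mono_pre_sigma[OF s s])
      fix \<omega> assume "\<omega> \<in> space M"
      then have "decseq (\<lambda>n. s n \<omega>)" using dec by (simp add: decseq_Suc_iff)
      then show "s (n + m) \<omega> \<le> s m \<omega>" by (simp add: decseq_def)
    qed
    then have [measurable]: "r (s (n + m)) X \<in> borel_measurable (sigma_at M F (s m))" for n
      using risk_measurable[OF s X, of "n + m"] by (auto simp: measurable_def space_pre_sigma)
    have "L' = (\<lambda>\<omega>. real_of_ereal (limsup (\<lambda>n. ereal (r (s (n + m)) X \<omega>))))"
    proof
      fix \<omega>
      show "L' \<omega> = real_of_ereal (limsup (\<lambda>n. ereal (r (s (n + m)) X \<omega>)))"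
        using limsup_shift_k[of "\<lambda>n. ereal (r (s n) X \<omega>)" m] by (simp only: L'_def)
    qed
    also have "\<dots> \<in> borel_measurable (sigma_at M F (s m))" by measurable
    finally show ?thesis .
  qed
  then have "L' -` B \<inter> space M \<in> sets (sigma_at M F (s m))" if "B \<in> sets borel" for m B
    using measurable_sets[OF _ that] by (metis space_pre_sigma)
  then have "L' \<in> borel_measurable (sigma_at M F \<sigma>)"
    by (intro measurableI) (auto simp: space_pre_sigma intro!: sets_sigma_at_right_limit[OF \<sigma> s le lim])
  moreover have "AE \<omega> in M. L' \<omega> = L \<omega>"
    using conv
  proof eventually_elim
    case (elim \<omega>)
    then have "limsup (\<lambda>n. ereal (r (s n) X \<omega>)) = ereal (L \<omega>)"
      by (intro lim_imp_Limsup) auto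
    then show ?case by (simp add: L'_def)
  qed
  ultimately have L_meas: "L \<in> borel_measurable (sigma_at M F \<sigma>)"
    by (rule measurable_sigma_at_AE_cong[OF \<sigma> _ L])
  have "AE \<omega> in M. \<forall>n. \<bar>r (s n) X \<omega>\<bar> \<le> C" using bound by (simp add: AE_all_countable)
  then have L_bound: "AE \<omega> in M. \<bar>L \<omega>\<bar> \<le> C"
    using conv by eventually_elim (rule LIMSEQ_le_const2[OF tendsto_rabs], auto)
  have LL: "L \<in> Linf M (sigma_at M F \<sigma>)"
    using L_meas L_bound by (auto simp: Linf_def)
  have VL: "r (s n) X \<in> Linf M M" for n by (rule risk_Linf_M[OF s X])
  \<comment> \<open>Since \<open>L\<close> is known at \<open>\<sigma>\<close>, the left side is
    \<open>L\<close> and this is the bound from above on \<open>L\<close>.\<close>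
  have "AE \<omega> in M. r \<sigma> (\<lambda>\<omega>. - L \<omega>) \<omega> \<le> r \<sigma> X \<omega>"
  proof (rule risk_fatou[OF \<sigma>, where f = "\<lambda>n \<omega>. - r (s n) X \<omega>" and C = C])
    show "AE \<omega> in M. (\<lambda>n. - r (s n) X \<omega>) \<longlonglongrightarrow> - L \<omega>"
      using conv by eventually_elim (rule tendsto_minus)
    show "AE \<omega> in M. r \<sigma> (\<lambda>\<omega>. - r (s n) X \<omega>) \<omega> \<le> r \<sigma> X \<omega>" for n
      by (rule eventually_mono[OF risk_tower[OF \<sigma> s le X, of n]]) simp_all
  qed (use L bound VL in \<open>auto intro: Linf_uminus\<close>)
  \<comment> \<open>By translation invariance the left side is \<open>r \<sigma> X - L\<close>, so
    this is the bound from below on \<open>L\<close>.\<close>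
  moreover have "AE \<omega> in M. r \<sigma> (\<lambda>\<omega>. X \<omega> + L \<omega>) \<omega> \<le> 0"
  proof (rule risk_fatou[OF \<sigma>, where f = "\<lambda>n \<omega>. X \<omega> + r (s n) X \<omega>" and C = "C + C"])
    show XV: "(\<lambda>\<omega>. X \<omega> + r (s n) X \<omega>) \<in> Linf M M" for n by (intro Linf_add X VL)
    show "(\<lambda>\<omega>. X \<omega> + L \<omega>) \<in> borel_measurable M" using X L by (auto simp: Linf_def)
    show "AE \<omega> in M. \<bar>X \<omega> + r (s n) X \<omega>\<bar> \<le> C + C" for n
      using C bound[of n] by eventually_elim linarith
    show "AE \<omega> in M. (\<lambda>n. X \<omega> + r (s n) X \<omega>) \<longlonglongrightarrow> X \<omega> + L \<omega>"
      using conv by eventually_elim (auto intro: tendsto_add)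
    show "AE \<omega> in M. r \<sigma> (\<lambda>\<omega>. X \<omega> + r (s n) X \<omega>) \<omega> \<le> 0" for n
    proof -
      \<comment> \<open>Adding its own risk as cash makes a position risk free at
        \<open>s n\<close>; the tower property carries the value zero back to
        \<open>\<sigma>\<close>.\<close>
      have "AE \<omega> in M. - r (s n) (\<lambda>\<omega>. X \<omega> + r (s n) X \<omega>) \<omega> = 0"
        using risk_add[OF s X risk_Linf[OF s X, of n]] by eventually_elim simp
      moreover have tower: "AE \<omega> in M. r \<sigma> (\<lambda>\<omega>. - r (s n) (\<lambda>\<omega>. X \<omega> + r (s n) X \<omega>) \<omega>) \<omega>
          = r \<sigma> (\<lambda>\<omega>. X \<omega> + r (s n) X \<omega>) \<omega>"
        by (rule risk_tower[OF \<sigma> s le XV])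
      ultimately have "AE \<omega> in M. r \<sigma> (\<lambda>\<omega>. - r (s n) (\<lambda>\<omega>. X \<omega> + r (s n) X \<omega>) \<omega>) \<omega> = r \<sigma> (\<lambda>_. 0) \<omega>"
        by (intro risk_cong[OF \<sigma>] Linf_uminus risk_Linf_M s XV Linf_const)
      then show ?thesis
        using tower risk_zero[OF \<sigma>] by eventually_elim simp
    qed
  qed
  moreover note risk_known[OF \<sigma> Linf_uminus[OF LL]] risk_add[OF \<sigma> X LL]
  ultimately show ?thesis by eventually_elim simp
qed

end

subsection \<open>Supermartingales under measures with zero penalty\<close>

text \<open>As a finite sum of indicators the count is visibly measurable.\<close>

lemma card_upcrossing_times_eq_sum:
  "card (upcrossing_times a b w n) = (\<Sum>j<n. of_bool (holding a b w j \<and> \<not> holding a b w (Suc j)))"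
  by (induction n) (auto simp: card_upcrossing_times_Suc upcrossing_times_def[of a b w 0])

lemma pred_holding:
  assumes "\<And>j. j \<le> k \<Longrightarrow> (\<lambda>\<omega>. w \<omega> j) \<in> borel_measurable N"
  shows "Measurable.pred N (\<lambda>\<omega>. holding a b (w \<omega>) k)"
  using assms
proof (induction k)
  case 0
  then have [measurable]: "(\<lambda>\<omega>. w \<omega> 0) \<in> borel_measurable N" by simp
  show ?case by (simp add: holding.simps)
next
  case (Suc k)
  then have [measurable]: "(\<lambda>\<omega>. w \<omega> (Suc k)) \<in> borel_measurable N"
    "Measurable.pred N (\<lambda>\<omega>. holding a b (w \<omega>) k)" by simp_all
  show ?case unfolding holding.simps by measurable
qed

text \<open>The penalty condition is kept only for positions of zero risk at time \<open>0\<close>,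
  which is the form in which it is applied. Equal null sets make almost sure statements under
  \<open>Q\<close> and \<open>M\<close> interchangeable.\<close>

locale zero_penalty_process = risk_process M F r
  for M :: "'a measure" and F r +
  fixes Q :: "'a measure"
  assumes prob_Q: "prob_space Q" and sets_Q: "sets Q = sets M" and null_sets_Q: "null_sets Q = null_sets M"
    and penalty: "\<And>X. X \<in> Linf M M \<Longrightarrow> AE \<omega> in M. r (\<lambda>_. 0) X \<omega> = 0 \<Longrightarrow> (\<integral>\<omega>. - X \<omega> \<partial>Q) \<le> 0"
begin

lemma space_Q: "space Q = space M"
  using sets_Q by (rule sets_eq_imp_space_eq)

lemma measurable_Q: "measurable Q N = measurable M N"
  by (rule measurable_cong_sets) (simp_all add: sets_Q)

lemma AE_Q: "(AE \<omega> in Q. P \<omega>) \<longleftrightarrow> (AE \<omega> in M. P \<omega>)"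
  unfolding eventually_ae_filter null_sets_Q space_Q by (rule refl)

lemma integrable_Q: "X \<in> Linf M M \<Longrightarrow> integrable Q X"
proof -
  assume "X \<in> Linf M M"
  then obtain C where "AE \<omega> in M. \<bar>X \<omega>\<bar> \<le> C" "X \<in> borel_measurable M" by (auto simp: Linf_def)
  then show ?thesis
    by (intro finite_measure.integrable_const_bound[OF prob_space.finite_measure[OF prob_Q], where B = C])
      (simp_all add: AE_Q measurable_Q)
qed

text \<open>The supermartingale inequality between stopping times, tested on events known at
  \<open>\<sigma>\<close>. The position \<open>W\<close> is \<open>- r \<tau> X\<close> made risk
  free at \<open>\<sigma>\<close> by adding cash and then restricted to \<open>A\<close>; its risk
  at time \<open>0\<close> vanishes, so the penalty condition applies.\<close>

lemma risk_supermartingale: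
  assumes \<sigma>: "stopping_time F \<sigma>" and \<tau>: "stopping_time F \<tau>"
    and le: "\<And>\<omega>. \<omega> \<in> space M \<Longrightarrow> \<sigma> \<omega> \<le> \<tau> \<omega>" and X: "X \<in> Linf M M"
    and A: "A \<in> sets (sigma_at M F \<sigma>)"
  shows "(\<integral>\<omega>. indicator A \<omega> * (r \<tau> X \<omega> - r \<sigma> X \<omega>) \<partial>Q) \<le> 0"
proof -
  define Z where "Z \<omega> = - r \<tau> X \<omega>" for \<omega>
  define W where "W \<omega> = indicator A \<omega> * (Z \<omega> + r \<sigma> X \<omega>)" for \<omega>
  have A_M: "A \<in> sets M" using A sets_sigma_at_subset[OF \<sigma>] by auto
  have Z: "Z \<in> Linf M M" unfolding Z_def by (intro Linf_uminus risk_Linf_M \<tau> X)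
  have ZX: "(\<lambda>\<omega>. Z \<omega> + r \<sigma> X \<omega>) \<in> Linf M M" by (intro Linf_add Z risk_Linf_M \<sigma> X)
  have W: "W \<in> Linf M M" unfolding W_def by (intro Linf_indicator_mult A_M ZX)
  have "AE \<omega> in M. r \<sigma> Z \<omega> = r \<sigma> X \<omega>"
    unfolding Z_def by (rule risk_tower[OF \<sigma> \<tau> le X])
  \<comment> \<open>By the tower property \<open>r \<sigma> X\<close> is the risk of
    \<open>Z\<close> at \<open>\<sigma>\<close>, so adding this cash cancels it, and locality keeps
    the risk zero after restriction to \<open>A\<close>.\<close>
  with risk_local[OF \<sigma> A ZX] risk_add[OF \<sigma> Z risk_Linf[OF \<sigma> X]]
  have "AE \<omega> in M. - r \<sigma> W \<omega> = 0"
    unfolding W_def by eventually_elim simp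
  then have "AE \<omega> in M. r (\<lambda>_. 0) (\<lambda>\<omega>. - r \<sigma> W \<omega>) \<omega> = r (\<lambda>_. 0) (\<lambda>_. 0) \<omega>"
    by (intro risk_cong Linf_uminus risk_Linf_M \<sigma> W Linf_const stopping_time_const)
  moreover have "AE \<omega> in M. r (\<lambda>_. 0) (\<lambda>\<omega>. - r \<sigma> W \<omega>) \<omega> = r (\<lambda>_. 0) W \<omega>"
    by (rule risk_tower[OF stopping_time_const \<sigma> _ W]) simp
  ultimately have "AE \<omega> in M. r (\<lambda>_. 0) W \<omega> = 0"
    using risk_zero[OF stopping_time_const, of 0] by eventually_elim simp
  from penalty[OF W this] show ?thesis
    by (simp add: W_def Z_def algebra_simps)
qed

text \<open>The pathwise gain inequality is integrated. Each holding event is known at time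
  \<open>t k\<close>, so the increments earn nothing on average. The bound depends neither on
  \<open>n\<close> nor on the times \<open>t\<close>, which is what refining the grids
  requires.\<close>

lemma upcrossings_integral_le:
  assumes X: "X \<in> Linf M M" and C: "AE \<omega> in M. \<bar>X \<omega>\<bar> \<le> C" and "a < b" and mono: "mono t"
  shows "(\<integral>\<^sup>+\<omega>. ennreal (card (upcrossing_times a b (\<lambda>k. r (\<lambda>_. t k) X \<omega>) n)) \<partial>Q) \<le> ennreal ((C + \<bar>a\<bar>) / (b - a))"
proof -
  define w where "w = (\<lambda>\<omega> k. r (\<lambda>_. t k) X \<omega>)"
  \<comment> \<open>The largest possible loss \<open>a - w \<omega> n\<close> on a position still
    open at the end.\<close>
  define K where "K = C + \<bar>a\<bar>"
  define H where "H k = {\<omega> \<in> space M. holding a b (w \<omega>) k}" for k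
  define N where "N \<omega> = card (upcrossing_times a b (w \<omega>) n)" for \<omega>
  interpret Q: prob_space Q by (rule prob_Q)
  have wL: "(\<lambda>\<omega>. w \<omega> k) \<in> Linf M M" for k
    unfolding w_def by (intro risk_Linf_M stopping_time_const X)
  have w_F: "(\<lambda>\<omega>. w \<omega> j) \<in> borel_measurable (sigma_at M F (\<lambda>_. t k))" if "j \<le> k" for j k
  proof -
    have "sets (sigma_at M F (\<lambda>_. t j)) \<subseteq> sets (sigma_at M F (\<lambda>_. t k))"
      using mono that by (intro mono_pre_sigma stopping_time_const) (auto simp: mono_def)
    then show ?thesis
      using risk_measurable[OF stopping_time_const X, of "t j"]
      by (auto simp: w_def measurable_def space_pre_sigma)
  qed
  have H_F: "H k \<in> sets (sigma_at M F (\<lambda>_. t k))" for k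
    using pred_holding[of k w "sigma_at M F (\<lambda>_. t k)" a b] w_F
    by (simp add: H_def pred_def space_pre_sigma)
  have H_M: "H k \<in> sets M" for k
    using H_F sets_sigma_at_subset[OF stopping_time_const] by blast
  have "Measurable.pred M (\<lambda>\<omega>. holding a b (w \<omega>) k)" for k
    using H_M by (simp add: H_def pred_def)
  note [measurable] = this
  have N_meas: "(\<lambda>\<omega>. real (N \<omega>)) \<in> borel_measurable M"
    unfolding N_def card_upcrossing_times_eq_sum by measurable
  have N_le: "N \<omega> \<le> n" for \<omega>
    unfolding N_def using card_mono[of "{..<n}" "upcrossing_times a b (w \<omega>) n"]
    by (auto simp: upcrossing_times_def)
  have NL: "(\<lambda>\<omega>. real (N \<omega>)) \<in> Linf M M"
    using N_meas N_le by (auto simp: Linf_def intro!: exI[of _ "real n"])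
  define G where "G k \<omega> = indicator (H k) \<omega> * (w \<omega> (Suc k) - w \<omega> k)" for k \<omega>
  have GL: "G k \<in> Linf M M" for k
    unfolding G_def diff_conv_add_uminus by (intro Linf_indicator_mult H_M Linf_add Linf_uminus wL)
  have G_int: "(\<integral>\<omega>. G k \<omega> \<partial>Q) \<le> 0" for k
    unfolding G_def w_def using mono
    by (intro risk_supermartingale stopping_time_const X H_F) (auto simp: mono_def)
  have w_bound: "AE \<omega> in M. \<bar>w \<omega> n\<bar> \<le> C"
    unfolding w_def by (intro risk_bounded stopping_time_const X C)
  have "AE \<omega> in M. (b - a) * N \<omega> \<le> (\<Sum>k<n. G k \<omega>) + K"
    using w_bound AE_space
  proof eventually_elim
    case (elim \<omega>)
    have "(\<Sum>k<n. G k \<omega>) = (\<Sum>k<n. of_bool (holding a b (w \<omega>) k) * (w \<omega> (Suc k) - w \<omega> k))"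
      using elim(2) by (intro sum.cong) (auto simp: G_def H_def)
    with upcrossing_gain[OF \<open>a < b\<close>, of "w \<omega>" n] elim(1) show ?case
      by (auto simp: N_def K_def split: if_splits)
  qed
  then have "(\<integral>\<omega>. (b - a) * N \<omega> \<partial>Q) \<le> (\<integral>\<omega>. (\<Sum>k<n. G k \<omega>) + K \<partial>Q)"
    using GL NL by (intro integral_mono_AE) (auto simp: AE_Q integrable_Q)
  also have "\<dots> = (\<Sum>k<n. \<integral>\<omega>. G k \<omega> \<partial>Q) + K"
    using GL by (simp add: integrable_Q Q.prob_space)
  also have "\<dots> \<le> K" using G_int by (simp add: sum_nonpos)
  finally have "(\<integral>\<omega>. real (N \<omega>) \<partial>Q) \<le> K / (b - a)"
    using \<open>a < b\<close> by (simp only: integral_mult_right_zero) (simp add: pos_le_divide_eq mult.commute)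
  moreover have "(\<integral>\<^sup>+\<omega>. ennreal (N \<omega>) \<partial>Q) = ennreal (\<integral>\<omega>. real (N \<omega>) \<partial>Q)"
    using NL by (intro nn_integral_eq_integral integrable_Q) auto
  ultimately show ?thesis
    by (auto simp: N_def K_def w_def intro: ennreal_leI)
qed

text \<open>Doob's bound is uniform over the grids, so by Fatou's lemma the limit inferior of the
  upcrossing counts is almost surely finite. Countably many rational levels and integer horizons
  leave a single null set.\<close>

lemma AE_finite_upcrossings:
  assumes X: "X \<in> Linf M M"
  shows "AE \<omega> in M. finite_upcrossings (\<lambda>s. r (\<lambda>_. ennreal s) X \<omega>)"
proof -
  obtain C where C: "AE \<omega> in M. \<bar>X \<omega>\<bar> \<le> C" using X by (auto simp: Linf_def)
  have "AE \<omega> in M. \<exists>m. \<exists>\<^sub>F n in sequentially.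
      card (upcrossing_times a b (\<lambda>k. r (\<lambda>_. ennreal (real k / 2 ^ n)) X \<omega>) (N * 2 ^ n)) < m"
    if "a < b" for a b N
  proof -
    define U where "U n \<omega> = card (upcrossing_times a b (\<lambda>k. r (\<lambda>_. ennreal (real k / 2 ^ n)) X \<omega>) (N * 2 ^ n))" for n \<omega>
    have [measurable]: "r (\<lambda>_. s) X \<in> borel_measurable M" for s
      using risk_Linf_M[OF stopping_time_const X] by (auto simp: Linf_def)
    define w where "w = (\<lambda>(n::nat) \<omega> (k::nat). r (\<lambda>_. ennreal (real k / 2 ^ n)) X \<omega>)"
    have "Measurable.pred M (\<lambda>\<omega>. holding a b (w n \<omega>) j)" for n j
      by (rule pred_holding) (simp add: w_def)
    note [measurable] = this
    have U_w: "U n \<omega> = card (upcrossing_times a b (w n \<omega>) (N * 2 ^ n))" for n \<omega>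
      by (simp add: U_def w_def)
    have U_meas[measurable]: "(\<lambda>\<omega>. ennreal (U n \<omega>)) \<in> borel_measurable M" for n
      unfolding U_w card_upcrossing_times_eq_sum by measurable
    have U_le: "(\<integral>\<^sup>+\<omega>. ennreal (U n \<omega>) \<partial>Q) \<le> ennreal ((C + \<bar>a\<bar>) / (b - a))" for n
      unfolding U_def
      by (intro upcrossings_integral_le[OF X C that] monoI ennreal_leI divide_right_mono) auto
    have "(\<integral>\<^sup>+\<omega>. liminf (\<lambda>n. ennreal (U n \<omega>)) \<partial>Q) \<le> liminf (\<lambda>n. \<integral>\<^sup>+\<omega>. ennreal (U n \<omega>) \<partial>Q)"
      by (rule nn_integral_liminf) (simp only: measurable_Q U_meas)
    also have "\<dots> \<le> ennreal ((C + \<bar>a\<bar>) / (b - a))"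
      using U_le by (intro Liminf_le) auto
    also have "\<dots> < \<infinity>" by simp
    finally have "AE \<omega> in Q. liminf (\<lambda>n. ennreal (U n \<omega>)) \<noteq> \<infinity>"
      by (intro nn_integral_PInf_AE) (simp_all only: measurable_Q, measurable)
    then have "AE \<omega> in M. liminf (\<lambda>n. ennreal (U n \<omega>)) \<noteq> \<infinity>" by (simp add: AE_Q)
    then show ?thesis
    proof eventually_elim
      case (elim \<omega>)
      show ?case
      proof (rule ccontr)
        assume "\<not> ?thesis"
        \<comment> \<open>If no bound held for infinitely many grids, every \<open>m\<close> would
          eventually be reached and the limit inferior would be infinite.\<close>
        then have *: "\<forall>\<^sub>F n in sequentially. m \<le> U n \<omega>" for m
          by (auto simp: U_def not_frequently not_less)
        have "of_nat m \<le> liminf (\<lambda>n. ennreal (U n \<omega>))" for m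
        proof (rule Liminf_bounded)
          show "\<forall>\<^sub>F n in sequentially. of_nat m \<le> ennreal (U n \<omega>)"
            using *[of m] by eventually_elim (simp add: ennreal_of_nat_eq_real_of_nat ennreal_leI)
        qed
        then have "liminf (\<lambda>n. ennreal (U n \<omega>)) = \<infinity>"
          by (metis elim ennreal_Ex_less_of_nat infinity_ennreal_def less_top not_less)
        then show False using elim by simp
      qed
    qed
  qed
  then have "AE \<omega> in M. a < b \<longrightarrow> (\<forall>N. \<exists>m. \<exists>\<^sub>F n in sequentially.
      card (upcrossing_times a b (\<lambda>k. r (\<lambda>_. ennreal (real k / 2 ^ n)) X \<omega>) (N * 2 ^ n)) < m)" for a b
    by (cases "a < b") (auto simp: AE_all_countable)
  then show ?thesis
    unfolding finite_upcrossings_def by (intro AE_ball_countable[THEN iffD2] ballI countable_rat)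
qed

text \<open>The hypothesis is tested on the event where the conditional expectation exceeds
  \<open>g\<close>. There the integrand is nonnegative and its integral is at most zero, so it
  vanishes almost everywhere.\<close>

lemma integral_le_imp_real_cond_exp_le:
  assumes G: "subalgebra Q G" and f: "integrable Q f" and g: "integrable Q g" "g \<in> borel_measurable G"
    and le: "\<And>A. A \<in> sets G \<Longrightarrow> (\<integral>\<omega>. indicator A \<omega> * (f \<omega> - g \<omega>) \<partial>Q) \<le> 0"
  shows "AE \<omega> in Q. real_cond_exp Q G f \<omega> \<le> g \<omega>"
proof -
  interpret Q: prob_space Q by (rule prob_Q)
  interpret S: finite_measure_subalgebra Q G
    by standard (rule G)
  define e where "e = real_cond_exp Q G f"
  have e: "integrable Q e" "e \<in> borel_measurable G"
    unfolding e_def using S.real_cond_exp_int[OF f] by auto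
  define A where "A = {\<omega> \<in> space G. g \<omega> < e \<omega>}"
  have A: "A \<in> sets G" unfolding A_def using g(2) e(2) by measurable
  then have A_Q: "A \<in> sets Q" using G by (auto simp: subalgebra_def)
  have int: "integrable Q (\<lambda>\<omega>. indicator A \<omega> * h \<omega>)" if "integrable Q h" for h :: "'a \<Rightarrow> real"
    using integrable_mult_indicator[OF A_Q that] by simp
  have "(\<integral>\<omega>. indicator A \<omega> * e \<omega> \<partial>Q) = (\<integral>\<omega>. indicator A \<omega> * f \<omega> \<partial>Q)"
    using S.real_cond_exp_intA[OF f A] by (simp add: set_lebesgue_integral_def e_def)
  then have "(\<integral>\<omega>. indicator A \<omega> * (e \<omega> - g \<omega>) \<partial>Q) = (\<integral>\<omega>. indicator A \<omega> * (f \<omega> - g \<omega>) \<partial>Q)"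
    using int[OF e(1)] int[OF f] int[OF g(1)] by (simp add: right_diff_distrib)
  then have le0: "(\<integral>\<omega>. indicator A \<omega> * (e \<omega> - g \<omega>) \<partial>Q) \<le> 0" using le[OF A] by simp
  have nonneg: "0 \<le> indicator A \<omega> * (e \<omega> - g \<omega>)" for \<omega>
    by (auto simp: A_def indicator_def)
  have "(\<integral>\<omega>. indicator A \<omega> * (e \<omega> - g \<omega>) \<partial>Q) = 0"
    using le0 nonneg by (intro antisym integral_nonneg_AE) auto
  then have "AE \<omega> in Q. indicator A \<omega> * (e \<omega> - g \<omega>) = 0"
    using nonneg int[of "\<lambda>\<omega>. e \<omega> - g \<omega>"] e(1) g(1)
    by (subst (asm) integral_nonneg_eq_0_iff_AE) auto
  then show ?thesis
    using AE_space
  proof eventually_elim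
    case (elim \<omega>)
    have "space G = space Q" using G by (simp add: subalgebra_def)
    then show ?case using elim by (auto simp: A_def e_def indicator_def split: if_splits)
  qed
qed

end

subsection \<open>The cadlag modification\<close>

context filtered_prob_space
begin

text \<open>The value infinity is kept apart because \<open>enn2real\<close> would send it to
  \<open>0\<close>, and the approximation would no longer lie above \<open>\<sigma>\<close>.\<close>

definition dyadic_stopping :: "('a \<Rightarrow> ennreal) \<Rightarrow> nat \<Rightarrow> 'a \<Rightarrow> ennreal" where
  "dyadic_stopping \<sigma> n \<omega> = (if \<sigma> \<omega> = \<infinity> then \<infinity> else ennreal (dyadic_above n (enn2real (\<sigma> \<omega>))))"

lemma dyadic_stopping_ennreal:
  "0 \<le> x \<Longrightarrow> \<sigma> \<omega> = ennreal x \<Longrightarrow> dyadic_stopping \<sigma> n \<omega> = ennreal (dyadic_above n x)"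
  by (simp add: dyadic_stopping_def)

lemma stopping_time_dyadic_stopping:
  assumes \<sigma>: "stopping_time F \<sigma>"
  shows "stopping_time F (dyadic_stopping \<sigma> n)"
proof (rule stopping_timeI)
  fix t :: ennreal
  show "Measurable.pred (F t) (\<lambda>\<omega>. dyadic_stopping \<sigma> n \<omega> \<le> t)"
  proof (cases t)
    case top
    then show ?thesis by simp
  next
    case (real u)
    \<comment> \<open>The largest grid point not exceeding \<open>u\<close>: the rounded time is at
      most \<open>t\<close> exactly when \<open>\<sigma>\<close> is below \<open>u'\<close>, an
      event known at \<open>u'\<close> and so at \<open>t\<close>.\<close>
    define u' where "u' = ennreal (real_of_int \<lfloor>u * 2 ^ n\<rfloor> / 2 ^ n)"
    have "0 \<le> u * 2 ^ n" using real by simp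
    then have nonneg: "0 \<le> real_of_int \<lfloor>u * 2 ^ n\<rfloor> / 2 ^ n" by simp
    have "u' \<le> t"
      unfolding u'_def real(2) by (intro ennreal_leI) (simp add: divide_le_eq)
    have "dyadic_stopping \<sigma> n \<omega> \<le> t \<longleftrightarrow> \<sigma> \<omega> < u'" for \<omega>
    proof (cases "\<sigma> \<omega>")
      case top
      then show ?thesis using real by (simp add: dyadic_stopping_def u'_def top_unique)
    next
      case x: (real x)
      have "dyadic_stopping \<sigma> n \<omega> \<le> t \<longleftrightarrow> dyadic_above n x \<le> u"
        using x real by (simp add: dyadic_stopping_ennreal[of x \<sigma> \<omega>, OF x(1,2)] ennreal_le_iff)
      also have "\<dots> \<longleftrightarrow> \<sigma> \<omega> < u'"
        unfolding dyadic_above_le_iff[OF x(1)] u'_def x(2) using x(1) nonneg by (simp add: ennreal_less_iff)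
      finally show ?thesis .
    qed
    moreover have "Measurable.pred (F t) (\<lambda>\<omega>. \<sigma> \<omega> < u')"
      using stopping_time_less_const[OF \<sigma>, of u'] sets_F_mono[OF \<open>u' \<le> t\<close>]
      by (auto simp: pred_def space_F)
    ultimately show ?thesis by simp
  qed
qed

lemma dyadic_stopping_ge: "\<sigma> \<omega> \<le> dyadic_stopping \<sigma> n \<omega>"
  by (cases "\<sigma> \<omega>") (auto simp: dyadic_stopping_def intro!: ennreal_leI less_imp_le[OF dyadic_above_greater])

lemma dyadic_stopping_Suc_le: "dyadic_stopping \<sigma> (Suc n) \<omega> \<le> dyadic_stopping \<sigma> n \<omega>"
  by (cases "\<sigma> \<omega>") (auto simp: dyadic_stopping_def intro!: ennreal_leI dyadic_above_Suc_le)

lemma dyadic_stopping_tendsto: "(\<lambda>n. dyadic_stopping \<sigma> n \<omega>) \<longlonglongrightarrow> \<sigma> \<omega>"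
  by (cases "\<sigma> \<omega>") (auto simp: dyadic_stopping_def intro!: tendsto_ennrealI dyadic_above_tendsto)

end

context zero_penalty_process
begin

text \<open>\<open>Y\<close> is the right limit of the risk along dyadic times. At a finite stopping
  time it is the limit of the risk at the dyadic roundings of that time, which right continuity
  identifies with the risk at the time itself.\<close>

lemma cadlag_modification:
  assumes X: "X \<in> Linf M M"
  obtains Y where "\<And>\<omega>. cadlag (\<lambda>t. Y t \<omega>)"
    and "\<And>\<sigma>. stopping_time F \<sigma> \<Longrightarrow> AE \<omega> in M. \<sigma> \<omega> < \<infinity> \<Longrightarrow>
      value_at Y \<sigma> \<in> Linf M (sigma_at M F \<sigma>) \<and> (AE \<omega> in M. r \<sigma> X \<omega> = value_at Y \<sigma> \<omega>)"
proof -
  define V where "V s \<omega> = r (\<lambda>_. ennreal s) X \<omega>" for s \<omega>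
  obtain C where C: "AE \<omega> in M. \<bar>X \<omega>\<bar> \<le> C" using X by (auto simp: Linf_def)
  have V_meas[measurable]: "V s \<in> borel_measurable M" for s
    using risk_Linf_M[OF stopping_time_const X] by (auto simp: V_def[abs_def] Linf_def)
  have "AE \<omega> in M. \<bar>V d \<omega>\<bar> \<le> C" for d
    unfolding V_def by (intro risk_bounded stopping_time_const X C)
  then have "AE \<omega> in M. \<forall>d\<in>nonneg_dyadics. \<bar>V d \<omega>\<bar> \<le> C"
    by (intro AE_ball_countable[THEN iffD2] countable_dyadics) auto
  moreover have "AE \<omega> in M. finite_upcrossings (\<lambda>s. V s \<omega>)"
    unfolding V_def by (rule AE_finite_upcrossings[OF X])
  ultimately have "AE \<omega> in M. finite_upcrossings (\<lambda>s. V s \<omega>) \<and> (\<forall>d\<in>nonneg_dyadics. \<bar>V d \<omega>\<bar> \<le> C)"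
    by simp
  then obtain N where N: "N \<in> null_sets M"
    and good: "\<And>\<omega>. \<omega> \<in> space M - N \<Longrightarrow> finite_upcrossings (\<lambda>s. V s \<omega>) \<and> (\<forall>d\<in>nonneg_dyadics. \<bar>V d \<omega>\<bar> \<le> C)"
    by (auto simp: eventually_ae_filter)
  have [measurable]: "N \<in> sets M" using N by auto
  \<comment> \<open>The value zero on the exceptional null set makes every path cadlag, not only
    almost every one.\<close>
  define Y where "Y t \<omega> = (if \<omega> \<in> space M - N then dyadic_right_limit (\<lambda>s. V s \<omega>) t else 0)" for t \<omega>
  have Y_lim: "(\<lambda>n. V (dyadic_above n t) \<omega>) \<longlonglongrightarrow> Y t \<omega>" if "\<omega> \<in> space M - N" "0 \<le> t" for \<omega> t
    using dyadic_above_tendsto_right_limit[of "\<lambda>s. V s \<omega>" C t] good[OF that(1)] that by (simp add: Y_def)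
  have Y_bound: "\<bar>Y t \<omega>\<bar> \<le> \<bar>C\<bar>" if "0 \<le> t" for t \<omega>
    using abs_dyadic_right_limit_le[of "\<lambda>s. V s \<omega>" C t] good[of \<omega>] that by (force simp: Y_def)
  have "cadlag (\<lambda>t. Y t \<omega>)" for \<omega>
  proof (cases "\<omega> \<in> space M - N")
    case True
    then have "(\<lambda>t. Y t \<omega>) = dyadic_right_limit (\<lambda>s. V s \<omega>)"
      by (auto simp: Y_def)
    then show ?thesis
      using cadlag_dyadic_right_limit[of "\<lambda>s. V s \<omega>" C] good[OF True] by simp
  next
    case False
    then have "(\<lambda>t. Y t \<omega>) = (\<lambda>_. 0)" by (auto simp: Y_def)
    then show ?thesis by (simp only: cadlag_const)
  qed
  moreover have "value_at Y \<sigma> \<in> Linf M (sigma_at M F \<sigma>) \<and> (AE \<omega> in M. r \<sigma> X \<omega> = value_at Y \<sigma> \<omega>)"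
    if \<sigma>: "stopping_time F \<sigma>" and fin: "AE \<omega> in M. \<sigma> \<omega> < \<infinity>" for \<sigma>
  proof -
    define s where "s = dyadic_stopping \<sigma>"
    have s: "stopping_time F (s n)" for n
      unfolding s_def by (rule stopping_time_dyadic_stopping[OF \<sigma>])
    have [measurable]: "\<sigma> \<in> borel_measurable M" by (rule stopping_time_measurable[OF \<sigma>])
    have lim: "(\<lambda>n. V (dyadic_above n (enn2real (\<sigma> \<omega>))) \<omega>) \<longlonglongrightarrow> value_at Y \<sigma> \<omega>"
      if "\<omega> \<in> space M - N" for \<omega>
      unfolding value_at_def by (rule Y_lim[OF that]) simp
    have val_meas: "value_at Y \<sigma> \<in> borel_measurable M"
    proof (rule borel_measurable_LIMSEQ_real)
      show "(\<lambda>n. if \<omega> \<in> N then 0 else V (dyadic_above n (enn2real (\<sigma> \<omega>))) \<omega>) \<longlonglongrightarrow> value_at Y \<sigma> \<omega>"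
        if "\<omega> \<in> space M" for \<omega>
        using lim[of \<omega>] that by (auto simp: value_at_def Y_def)
      fix n
      have [measurable]: "(\<lambda>\<omega>. nat \<lfloor>enn2real (\<sigma> \<omega>) * 2 ^ n\<rfloor>) \<in> M \<rightarrow>\<^sub>M count_space UNIV"
        by measurable
      have "(\<lambda>\<omega>. V (real (nat \<lfloor>enn2real (\<sigma> \<omega>) * 2 ^ n\<rfloor> + 1) / 2 ^ n) \<omega>) \<in> borel_measurable M"
        \<comment> \<open>The rounded time has only countably many values, so sampling
          \<open>V\<close> at it is measurable although no joint measurability of \<open>V\<close>
          in time and state is known.\<close>
        by (rule measurable_compose_countable[where f = "\<lambda>k. V (real (k + 1) / 2 ^ n)"]) measurable
      then have [measurable]: "(\<lambda>\<omega>. V (dyadic_above n (enn2real (\<sigma> \<omega>))) \<omega>) \<in> borel_measurable M"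
        by (simp only: dyadic_above_def)
      show "(\<lambda>\<omega>. if \<omega> \<in> N then 0 else V (dyadic_above n (enn2real (\<sigma> \<omega>))) \<omega>) \<in> borel_measurable M"
        by measurable
    qed
    \<comment> \<open>The risk at the stopping time \<open>s n\<close> agrees with the risk at the
      fixed time \<open>d\<close> where both times coincide. Countably many pairs of
      \<open>d\<close> and \<open>n\<close> share one null set.\<close>
    have "AE \<omega> in M. \<forall>d\<in>nonneg_dyadics. \<forall>n. s n \<omega> = ennreal d \<longrightarrow> r (s n) X \<omega> = V d \<omega>"
      unfolding V_def
      by (intro AE_ball_countable[THEN iffD2] AE_all_countable[THEN iffD2] countable_dyadics ballI allI
          risk_eq_on_eq s stopping_time_const X)
    then have conv: "AE \<omega> in M. (\<lambda>n. r (s n) X \<omega>) \<longlonglongrightarrow> value_at Y \<sigma> \<omega>"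
      using fin AE_not_in[OF N] AE_space
    proof eventually_elim
      case (elim \<omega>)
      obtain x where x: "0 \<le> x" "\<sigma> \<omega> = ennreal x"
        using elim(2) by (cases "\<sigma> \<omega>") auto
      have "r (s n) X \<omega> = V (dyadic_above n (enn2real (\<sigma> \<omega>))) \<omega>" for n
        using elim(1) x dyadic_above_dyadic dyadic_stopping_ennreal[of x \<sigma> \<omega>, OF x] by (simp add: s_def)
      then show ?case using lim[of \<omega>] elim by simp
    qed
    have eq: "AE \<omega> in M. r \<sigma> X \<omega> = value_at Y \<sigma> \<omega>"
      by (rule risk_right_continuous[OF \<sigma> s _ _ _ X val_meas conv])
        (simp_all add: s_def dyadic_stopping_ge dyadic_stopping_Suc_le dyadic_stopping_tendsto)
    \<comment> \<open>So far the value is measurable only for \<open>M\<close>. Its almost sure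
      equality with a variable known at \<open>\<sigma>\<close> improves this, since the filtration
      contains the null sets.\<close>
    have "value_at Y \<sigma> \<in> borel_measurable (sigma_at M F \<sigma>)"
      by (rule measurable_sigma_at_AE_cong[OF \<sigma> risk_measurable[OF \<sigma> X] val_meas eq])
    moreover have "\<bar>value_at Y \<sigma> \<omega>\<bar> \<le> \<bar>C\<bar>" for \<omega>
      unfolding value_at_def by (rule Y_bound) simp
    ultimately show ?thesis using eq by (auto simp: Linf_def)
  qed
  ultimately show ?thesis using that by blast
qed

text \<open>At constant times \<open>Y\<close> is a version of the risk process, so the inequality
  tested on events of \<open>F s\<close> carries over from the risk.\<close>

lemma supermartingale_cadlag_modification:
  assumes X: "X \<in> Linf M M"
    and Y: "\<And>\<sigma>. stopping_time F \<sigma> \<Longrightarrow> AE \<omega> in M. \<sigma> \<omega> < \<infinity> \<Longrightarrow>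
      value_at Y \<sigma> \<in> Linf M (sigma_at M F \<sigma>) \<and> (AE \<omega> in M. r \<sigma> X \<omega> = value_at Y \<sigma> \<omega>)"
  shows "supermartingale Q F Y"
proof -
  have at_const: "Y t \<in> Linf M (sigma_at M F (\<lambda>_. ennreal t)) \<and> (AE \<omega> in M. r (\<lambda>_. ennreal t) X \<omega> = Y t \<omega>)"
    if "0 \<le> t" for t
  proof -
    have "value_at Y (\<lambda>_. ennreal t) = Y t" using that by (auto simp: value_at_def)
    then show ?thesis using Y[OF stopping_time_const, of "ennreal t"] by simp
  qed
  have L: "Y t \<in> Linf M M" if "0 \<le> t" for t
    using at_const[OF that] Linf_sigma_at[OF stopping_time_const] by blast
  have meas: "Y t \<in> borel_measurable (F (ennreal t))" if "0 \<le> t" for t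
    using at_const[OF that] measurable_cong_sets[OF sets_sigma_at_const refl] by (auto simp: Linf_def)
  have "AE \<omega> in Q. real_cond_exp Q (F (ennreal s)) (Y t) \<omega> \<le> Y s \<omega>" if st: "0 \<le> s" "s \<le> t" for s t
  proof (rule integral_le_imp_real_cond_exp_le)
    have t: "0 \<le> t" using st by simp
    show "subalgebra Q (F (ennreal s))"
      using sets_F_mono[of "ennreal s" \<top>] by (simp add: subalgebra_def space_F space_Q sets_Q sets_F_infinity)
    show "integrable Q (Y t)" "integrable Q (Y s)" "Y s \<in> borel_measurable (F (ennreal s))"
      using L st meas by (auto intro: integrable_Q)
    fix A assume "A \<in> sets (F (ennreal s))"
    then have A: "A \<in> sets (sigma_at M F (\<lambda>_. ennreal s))" by (simp add: sets_sigma_at_const)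
    then have [measurable]: "A \<in> sets M" using sets_sigma_at_subset[OF stopping_time_const] by blast
    have [measurable]: "Y t \<in> borel_measurable M" "Y s \<in> borel_measurable M"
      "r (\<lambda>_. ennreal u) X \<in> borel_measurable M" for u
      using L[OF t] L[OF st(1)] risk_Linf_M[OF stopping_time_const X] by (auto simp: Linf_def)
    have "AE \<omega> in M. r (\<lambda>_. ennreal t) X \<omega> = Y t \<omega>" "AE \<omega> in M. r (\<lambda>_. ennreal s) X \<omega> = Y s \<omega>"
      using at_const t st by auto
    then have "AE \<omega> in Q. indicator A \<omega> * (Y t \<omega> - Y s \<omega>)
        = indicator A \<omega> * (r (\<lambda>_. ennreal t) X \<omega> - r (\<lambda>_. ennreal s) X \<omega>)"
      unfolding AE_Q by eventually_elim simp
    then have "(\<integral>\<omega>. indicator A \<omega> * (Y t \<omega> - Y s \<omega>) \<partial>Q)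
        = (\<integral>\<omega>. indicator A \<omega> * (r (\<lambda>_. ennreal t) X \<omega> - r (\<lambda>_. ennreal s) X \<omega>) \<partial>Q)"
      by (intro integral_cong_AE) (simp_all only: measurable_Q, measurable)
    also have "\<dots> \<le> 0"
      using st by (intro risk_supermartingale stopping_time_const X A) (simp add: ennreal_leI)
    finally show "(\<integral>\<omega>. indicator A \<omega> * (Y t \<omega> - Y s \<omega>) \<partial>Q) \<le> 0" .
  qed
  then show ?thesis
    using L meas by (auto simp: supermartingale_def intro: integrable_Q)
qed

end

section \<open>From the dynamic risk measure and its zero penalty measures to the locales\<close>

context filtered_prob_space
begin

lemma Linf_infinity: "Linf M (sigma_at M F (\<lambda>_. \<infinity>)) = Linf M M"
  unfolding Linf_def measurable_cong_sets[OF sets_sigma_at_const[of \<infinity>, unfolded sets_F_top] refl] ..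

lemma ordered_infinity: "stopping_time F \<sigma> \<Longrightarrow> ordered_stopping_times M F \<sigma> (\<lambda>_. \<infinity>)"
  by (simp add: ordered_stopping_times_def stopping_time_const)

text \<open>Only the tower property needs an argument, because time consistency evaluates the
  intermediate position \<open>W\<close> with terminal time \<open>\<sigma>\<close> in place of
  infinity.\<close>

lemma risk_process_of_dynamic_risk_measure:
  assumes dyn: "dynamic_risk_measure M F \<rho>" and tc: "time_consistent M F \<rho>"
    and cont: "continuous_from_above M F \<rho>" and norm: "normalized M F \<rho>"
  shows "risk_process M F (\<lambda>\<sigma>. \<rho> \<sigma> (\<lambda>_. \<infinity>))"
proof unfold_locales
  note D = dyn[unfolded dynamic_risk_measure_def, rule_format]
  fix \<sigma> assume \<sigma>: "stopping_time F \<sigma>"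
  note D\<sigma> = D[OF ordered_infinity[OF \<sigma>], unfolded Linf_infinity]
  show Linf: "\<rho> \<sigma> (\<lambda>_. \<infinity>) X \<in> Linf M (sigma_at M F \<sigma>)" if "X \<in> Linf M M" for X
    using D\<sigma> that by blast
  show "AE \<omega> in M. \<rho> \<sigma> (\<lambda>_. \<infinity>) Y \<omega> \<le> \<rho> \<sigma> (\<lambda>_. \<infinity>) X \<omega>"
    if "X \<in> Linf M M" "Y \<in> Linf M M" "AE \<omega> in M. X \<omega> \<le> Y \<omega>" for X Y
    using D\<sigma> that by blast
  show add: "AE \<omega> in M. \<rho> \<sigma> (\<lambda>_. \<infinity>) (\<lambda>\<omega>. X \<omega> + Z \<omega>) \<omega> = \<rho> \<sigma> (\<lambda>_. \<infinity>) X \<omega> - Z \<omega>"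
    if "X \<in> Linf M M" "Z \<in> Linf M (sigma_at M F \<sigma>)" for X Z
    using D\<sigma> that by blast
  show zero: "AE \<omega> in M. \<rho> \<sigma> (\<lambda>_. \<infinity>) (\<lambda>_. 0) \<omega> = 0"
    using norm ordered_infinity[OF \<sigma>] by (simp add: normalized_def)
  show "AE \<omega> in M. (\<lambda>n. \<rho> \<sigma> (\<lambda>_. \<infinity>) (Xn n) \<omega>) \<longlonglongrightarrow> \<rho> \<sigma> (\<lambda>_. \<infinity>) X \<omega>"
    if "X \<in> Linf M M" "\<And>n::nat. Xn n \<in> Linf M M" "AE \<omega> in M. decseq (\<lambda>n. Xn n \<omega>)"
      "AE \<omega> in M. (\<lambda>n. Xn n \<omega>) \<longlonglongrightarrow> X \<omega>" for X Xn
    using cont[unfolded continuous_from_above_def, rule_format, OF ordered_infinity[OF \<sigma>], unfolded Linf_infinity] that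
    by blast
  fix \<nu> X assume \<nu>: "stopping_time F \<nu>" and le: "\<And>\<omega>. \<omega> \<in> space M \<Longrightarrow> \<nu> \<omega> \<le> \<sigma> \<omega>" and X: "X \<in> Linf M M"
  have ord: "ordered_stopping_times M F \<nu> \<sigma>"
    using \<nu> \<sigma> le by (simp add: ordered_stopping_times_def)
  note T = tc[unfolded time_consistent_def, rule_format, OF ord ordered_infinity[OF \<sigma>], unfolded Linf_infinity]
  define W where "W \<omega> = - \<rho> \<sigma> (\<lambda>_. \<infinity>) X \<omega>" for \<omega>
  have W: "W \<in> Linf M (sigma_at M F \<sigma>)" unfolding W_def by (intro Linf_uminus Linf X)
  then have W_M: "W \<in> Linf M M"
    by (rule Linf_mono[OF space_pre_sigma sets_sigma_at_subset[OF \<sigma>]])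
  \<comment> \<open>Applying time consistency to \<open>W\<close> as well gives the risk up to
    infinity of \<open>W\<close> as the risk up to \<open>\<sigma>\<close> of \<open>W'\<close>. As
    \<open>W\<close> is known at \<open>\<sigma>\<close>, \<open>W'\<close> and \<open>W\<close>
    agree almost surely, and monotonicity in both directions equates their risks.\<close>
  define W' where "W' \<omega> = - \<rho> \<sigma> (\<lambda>_. \<infinity>) W \<omega>" for \<omega>
  have W': "W' \<in> Linf M (sigma_at M F \<sigma>)" unfolding W'_def by (intro Linf_uminus Linf W_M)
  have "AE \<omega> in M. W' \<omega> = W \<omega>"
    unfolding W'_def using add[OF Linf_const W, of 0] zero by eventually_elim simp
  then have "AE \<omega> in M. W' \<omega> \<le> W \<omega>" "AE \<omega> in M. W \<omega> \<le> W' \<omega>" by (auto elim: eventually_mono)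
  then have "AE \<omega> in M. \<rho> \<nu> \<sigma> W \<omega> \<le> \<rho> \<nu> \<sigma> W' \<omega>" "AE \<omega> in M. \<rho> \<nu> \<sigma> W' \<omega> \<le> \<rho> \<nu> \<sigma> W \<omega>"
    using D[OF ord] W W' by blast+
  then show "AE \<omega> in M. \<rho> \<nu> (\<lambda>_. \<infinity>) (\<lambda>\<omega>. - \<rho> \<sigma> (\<lambda>_. \<infinity>) X \<omega>) \<omega> = \<rho> \<nu> (\<lambda>_. \<infinity>) X \<omega>"
    using T[OF X] T[OF W_M] unfolding W_def[symmetric] W'_def[symmetric]
    by eventually_elim simp
qed

text \<open>Null sets have probability zero, and the sets of probability zero or one are closed
  under complements and countable unions.\<close>

lemma F_0_trivial:
  assumes "A \<in> sets (F 0)"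
  shows "measure M A = 0 \<or> measure M A = 1"
proof -
  have "A \<in> sigma_sets (space M) (null_sets M)" using assms sets_F_0 by simp
  then have "A \<in> sets M \<and> (measure M A = 0 \<or> measure M A = 1)"
  proof (induction rule: sigma_sets.induct)
    case (Basic a)
    then show ?case by (auto simp: measure_def)
  next
    case Empty
    then show ?case by simp
  next
    case (Compl a)
    then show ?case by (auto simp: prob_compl)
  next
    case (Union a)
    show ?case
    proof (cases "\<exists>i. measure M (a i) = 1")
      case True
      then obtain i where i: "measure M (a i) = 1" by auto
      have "measure M (a i) \<le> measure M (\<Union>i. a i)"
        using Union.IH by (intro finite_measure_mono) auto
      then show ?thesis using Union.IH i by (auto intro: antisym)
    next
      case False
      then have "a i \<in> null_sets M" for i
        using Union.IH[of i] by (auto simp: emeasure_eq_measure intro!: null_setsI)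
      then have "(\<Union>i. a i) \<in> null_sets M" by auto
      then show ?thesis using Union.IH by (auto simp: measure_def)
    qed
  qed
  then show ?thesis by simp
qed

end

context risk_process
begin

text \<open>Zero penalty bounds the conditional expectation of \<open>- X\<close> by the risk at
  time \<open>0\<close>. If \<open>Q\<close> does not charge \<open>A\<close>, all positive
  multiples of the indicator of \<open>A\<close> therefore have zero risk, and non-degeneracy makes
  \<open>A\<close> null for \<open>M\<close>.\<close>

lemma zero_penalty_processI:
  assumes Q: "prob_space Q" "sets Q = sets M" "absolutely_continuous M Q"
    and pen: "is_min_penalty M F (\<lambda>\<sigma> \<tau>. r \<sigma>) (\<lambda>_. 0) (\<lambda>_. \<infinity>) Q (\<lambda>_. 0)"
    and nd: "\<And>A. A \<in> sets M \<Longrightarrow> \<forall>c>0. AE \<omega> in M. r (\<lambda>_. 0) (\<lambda>\<omega>. c * indicator A \<omega>) \<omega> = r (\<lambda>_. 0) (\<lambda>_. 0) \<omega>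
      \<Longrightarrow> measure M A = 0"
  shows "zero_penalty_process M F r Q"
proof -
  interpret Q: prob_space Q by (rule Q(1))
  let ?G = "sigma_at M F (\<lambda>_. 0)"
  have zero: "stopping_time F (\<lambda>_. 0)" by (rule stopping_time_const)
  have space_Q: "space Q = space M" by (rule sets_eq_imp_space_eq[OF Q(2)])
  have AE_Q: "AE \<omega> in Q. P \<omega>" if "AE \<omega> in M. P \<omega>" for P
    using that Q(3) unfolding eventually_ae_filter space_Q absolutely_continuous_def by blast
  interpret S: finite_measure_subalgebra Q ?G
    using subalgebra_sigma_at[OF zero] Q(2) space_Q by unfold_locales (simp add: subalgebra_def)
  have int: "integrable Q X" if "X \<in> Linf M M" for X
  proof -
    obtain C where C: "AE \<omega> in M. \<bar>X \<omega>\<bar> \<le> C" "X \<in> borel_measurable M" using \<open>X \<in> Linf M M\<close> by (auto simp: Linf_def)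
    have "X \<in> borel_measurable Q" using C(2) measurable_cong_sets[OF Q(2) refl] by auto
    then show ?thesis
      using AE_Q[OF C(1)] by (intro Q.integrable_const_bound[where B = C]) auto
  qed
  \<comment> \<open>Of the essential supremum only the upper bound enters: each member of the family
    is at most zero.\<close>
  have le: "AE \<omega> in Q. real_cond_exp Q ?G (\<lambda>\<omega>. - X \<omega>) \<omega> \<le> r (\<lambda>_. 0) X \<omega>" if "X \<in> Linf M M" for X
    using pen that unfolding is_min_penalty_def is_ess_sup_def Linf_infinity by (auto simp: zero_ereal_def)
  have int_le: "(\<integral>\<omega>. - X \<omega> \<partial>Q) \<le> (\<integral>\<omega>. r (\<lambda>_. 0) X \<omega> \<partial>Q)" if X: "X \<in> Linf M M" for X
  proof -
    have "(\<integral>\<omega>. - X \<omega> \<partial>Q) = (\<integral>\<omega>. real_cond_exp Q ?G (\<lambda>\<omega>. - X \<omega>) \<omega> \<partial>Q)"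
      using S.real_cond_exp_int(2)[OF int[OF Linf_uminus[OF X]]] by simp
    also have "\<dots> \<le> (\<integral>\<omega>. r (\<lambda>_. 0) X \<omega> \<partial>Q)"
      using le[OF X] int[OF Linf_uminus[OF X]] int[OF risk_Linf_M[OF zero X]]
      by (intro integral_mono_AE S.real_cond_exp_int(1))
    finally show ?thesis .
  qed
  have "A \<in> null_sets M" if A: "A \<in> null_sets Q" for A
  proof -
    have A_M: "A \<in> sets M" using A Q(2) by auto
    have "AE \<omega> in M. r (\<lambda>_. 0) (\<lambda>\<omega>. c * indicator A \<omega>) \<omega> = r (\<lambda>_. 0) (\<lambda>_. 0) \<omega>" if "0 < c" for c
    proof -
      have ind: "(\<lambda>\<omega>. c * indicator A \<omega>) \<in> Linf M M"
        using Linf_indicator_mult[OF A_M Linf_const, of c] by (simp add: mult.commute)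
      define R where "R = r (\<lambda>_. 0) (\<lambda>\<omega>. c * indicator A \<omega>)"
      \<comment> \<open>Under \<open>Q\<close> the risk is nonnegative, so \<open>B\<close> is null
        for \<open>Q\<close>. To obtain the same under \<open>M\<close>, triviality of
        \<open>F 0\<close> is used: \<open>B\<close> has probability zero or one, and one would
        contradict absolute continuity.\<close>
      define B where "B = {\<omega> \<in> space M. R \<omega> < 0}"
      have R_meas: "R \<in> borel_measurable ?G" unfolding R_def by (rule risk_measurable[OF zero ind])
      have "B \<in> sets ?G"
        using R_meas unfolding B_def by (subst space_pre_sigma[symmetric]) measurable
      then have B: "B \<in> sets (F 0)" by (simp add: sets_sigma_at_const)
      then have B_M: "B \<in> sets M" using sets_F_mono[of 0 \<top>] sets_F_infinity by auto
      have "AE \<omega> in Q. - (c * indicator A \<omega>) = (0::real)"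
        using AE_not_in[OF A] by eventually_elim simp
      then have "AE \<omega> in Q. real_cond_exp Q ?G (\<lambda>\<omega>. - (c * indicator A \<omega>)) \<omega> = real_cond_exp Q ?G (\<lambda>_. 0) \<omega>"
        using A by (intro S.real_cond_exp_cong) auto
      moreover have "AE \<omega> in Q. real_cond_exp Q ?G (\<lambda>_. 0) \<omega> = (0::real)"
        by (intro S.real_cond_exp_F_meas) auto
      ultimately have "AE \<omega> in Q. 0 \<le> R \<omega>"
        using le[OF ind] unfolding R_def by eventually_elim simp
      then have not_B: "AE \<omega> in Q. \<omega> \<notin> B" by eventually_elim (simp add: B_def)
      have "\<not> (AE \<omega> in Q. \<omega> \<in> B)"
      proof
        assume "AE \<omega> in Q. \<omega> \<in> B"
        with not_B have "AE \<omega> in Q. False" by eventually_elim simp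
        then show False by simp
      qed
      then have "\<not> (AE \<omega> in M. \<omega> \<in> B)" using AE_Q by blast
      then have "measure M B \<noteq> 1" using AE_prob_1 by blast
      then have "measure M B = 0" using F_0_trivial[OF B] by simp
      then have "B \<in> null_sets M" using B_M by (simp add: emeasure_eq_measure null_setsI)
      then have "AE \<omega> in M. \<omega> \<notin> B" by (rule AE_not_in)
      \<comment> \<open>The opposite inequality is monotonicity, as the position is
        nonnegative.\<close>
      moreover have "AE \<omega> in M. R \<omega> \<le> r (\<lambda>_. 0) (\<lambda>_. 0) \<omega>"
        unfolding R_def using that by (intro risk_mono zero Linf_const ind) (auto simp: indicator_def)
      ultimately show ?thesis
        using risk_zero[OF zero] AE_space unfolding R_def[symmetric]
        by eventually_elim (auto simp: B_def)
    qed
    then have "measure M A = 0" using nd[OF A_M] by blast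
    then show ?thesis using A_M by (simp add: emeasure_eq_measure null_setsI)
  qed
  then have null: "null_sets Q = null_sets M"
    using Q(3) by (auto simp: absolutely_continuous_def)
  have "(\<integral>\<omega>. - X \<omega> \<partial>Q) \<le> 0" if X: "X \<in> Linf M M" and X0: "AE \<omega> in M. r (\<lambda>_. 0) X \<omega> = 0" for X
  proof -
    have "(\<integral>\<omega>. r (\<lambda>_. 0) X \<omega> \<partial>Q) = 0"
      using AE_Q[OF X0] int[OF risk_Linf_M[OF zero X]] by (intro integral_eq_zero_AE)
    then show ?thesis using int_le[OF X] by simp
  qed
  then show ?thesis
    using Q null by unfold_locales auto
qed

end

theorem corollary2p5:
  fixes M :: "'a measure" and F :: "ennreal \<Rightarrow> 'a measure" and \<rho> :: "'a risk"
    and X :: "'a \<Rightarrow> real" and Q :: "'a measure"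
  assumes "filtered_prob_space M F"
    and "dynamic_risk_measure M F \<rho>"
    and "time_consistent M F \<rho>"
    and "continuous_from_above M F \<rho>"
    and "normalized M F \<rho>"
    and "non_degenerate M \<rho>"
    and "zero_penalty_measures M F \<rho> \<noteq> {} \<or> continuous_from_below M F \<rho>"
    and "X \<in> Linf M M"
    and "Q \<in> zero_penalty_measures M F \<rho>"
  shows "\<exists>Y. supermartingale Q F Y \<and> (\<forall>\<omega>\<in>space M. cadlag (\<lambda>t. Y t \<omega>)) \<and>
           (\<forall>\<sigma>. stopping_time F \<sigma> \<and> (AE \<omega> in M. \<sigma> \<omega> < \<infinity>) \<longrightarrow>
              value_at Y \<sigma> \<in> Linf M (sigma_at M F \<sigma>) \<and>
              (AE \<omega> in M. \<rho> \<sigma> (\<lambda>_. \<infinity>) X \<omega> = value_at Y \<sigma> \<omega>))"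
proof -
  interpret filtered_prob_space M F by fact
  interpret risk_process M F "\<lambda>\<sigma>. \<rho> \<sigma> (\<lambda>_. \<infinity>)"
    by (rule risk_process_of_dynamic_risk_measure) fact+
  have "zero_penalty_process M F (\<lambda>\<sigma>. \<rho> \<sigma> (\<lambda>_. \<infinity>)) Q"
  proof (rule zero_penalty_processI)
    show "prob_space Q" "sets Q = sets M" "absolutely_continuous M Q"
      "is_min_penalty M F (\<lambda>\<sigma> \<tau>. \<rho> \<sigma> (\<lambda>_. \<infinity>)) (\<lambda>_. 0) (\<lambda>_. \<infinity>) Q (\<lambda>_. 0)"
      using assms(9) by (simp_all add: zero_penalty_measures_def is_min_penalty_def)
    show "measure M A = 0" if "A \<in> sets M"
      "\<forall>c>0. AE \<omega> in M. \<rho> (\<lambda>_. 0) (\<lambda>_. \<infinity>) (\<lambda>\<omega>. c * indicator A \<omega>) \<omega> = \<rho> (\<lambda>_. 0) (\<lambda>_. \<infinity>) (\<lambda>_. 0) \<omega>" for A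
      using assms(6) that unfolding non_degenerate_def by blast
  qed
  then interpret zero_penalty_process M F "\<lambda>\<sigma>. \<rho> \<sigma> (\<lambda>_. \<infinity>)" Q .
  obtain Y where Y: "\<And>\<omega>. cadlag (\<lambda>t. Y t \<omega>)"
    "\<And>\<sigma>. stopping_time F \<sigma> \<Longrightarrow> AE \<omega> in M. \<sigma> \<omega> < \<infinity> \<Longrightarrow>
      value_at Y \<sigma> \<in> Linf M (sigma_at M F \<sigma>) \<and> (AE \<omega> in M. \<rho> \<sigma> (\<lambda>_. \<infinity>) X \<omega> = value_at Y \<sigma> \<omega>)"
    using cadlag_modification[OF assms(8)] by metis
  have "supermartingale Q F Y"
    by (rule supermartingale_cadlag_modification[OF assms(8)]) (rule Y(2))
  then show ?thesis using Y by blast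
qed

end
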